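(* Let $A$ be a totally ordered set. The set $\mathbf{YT}_A\times\mathbb{N}_0$ is a braided commutative monoid in each of the following two ways. (1) The unit is $(\emptyset,0)$, the product is $(T_1,\alpha_1)\ast_R(T_2,\alpha_2)=(T_1\ast T_2,\ \alpha_1+\alpha_2+\operatorname{rows}(T_1)+\operatorname{rows}(T_2)-\operatorname{rows}(T_1\ast T_2))$, and the braiding $\boldsymbol{\sigma}_R((T_1,\alpha_1),(T_2,\alpha_2))=((T'_2,\alpha'_2),(T'_1,\alpha'_1))$ is the unique pair satisfying: the rows of $T'_2$ (on top) followed by the rows of $T'_1$ (below) form the tableau $T_1\ast T_2$; $\alpha'_1+\operatorname{rows}(T'_1)=\alpha_1+\operatorname{rows}(T_1)$ and $\alpha'_2+\operatorname{rows}(T'_2)=\alpha_2+\operatorname{rows}(T_2)$; and $\alpha'_1>0$ if and only if $\operatorname{rows}(T_1\ast T_2)<\alpha_1+\operatorname{rows}(T_1)$, in which case $T'_2=\emptyset$. (2) The unit is $(\emptyset,0)$, the product is $(T_1,\alpha_1)\ast_C(T_2,\alpha_2)=(T_1\ast T_2,\ \alpha_1+\alpha_2+\operatorname{cols}(T_1)+\operatorname{cols}(T_2)-\operatorname{cols}(T_1\ast T_2))$, and the braiding $\boldsymbol{\sigma}_C((T_1,\alpha_1),(T_2,\alpha_2))=((T'_2,\alpha'_2),(T'_1,\alpha'_1))$ is the unique pair satisfying: the columns of $T'_2$ (on the left) followed by the columns of $T'_1$ (on the right) form the tableau $T_1\ast T_2$; $\alpha'_1+\operatorname{cols}(T'_1)=\alpha_1+\operatorname{cols}(T_1)$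 and $\alpha'_2+\operatorname{cols}(T'_2)=\alpha_2+\operatorname{cols}(T_2)$; and $\alpha'_2>0$ if and only if $\operatorname{cols}(T_1\ast T_2)<\alpha_2+\operatorname{cols}(T_2)$, in which case $T'_1=\emptyset$.
   Context: $\mathbb{N}_0=\{0,1,2,\dots\}$. An $A$-row is a non-decreasing word in $A^*$; for rows write $x_1\ldots x_s \succ_R y_1\ldots y_t$ if $s\le t$ and $x_i>y_i$ for all $i\le s$. A Young tableau on $A$ is a finite sequence $T=(r_1,\dots,r_k)$ of non-empty rows with $r_1\succ_R\cdots\succ_R r_k$, drawn as left-justified rows with $r_1$ on top and $r_k$ at the bottom; $\operatorname{rows}(T)=k$ and $\operatorname{cols}(T)$ is the number of columns (the length of $r_k$); $\mathbf{YT}_A$ is the set of Young tableaux including the empty tableau $\emptyset$. Row reading: $\mathcal{R}(T)=r_1\cdots r_k$. Right Schensted insertion of $x\in A$ into $T$: if $T=\emptyset$ the result is $(x)$; if $x\ge$ the last letter of $r_k$, append $x$ to $r_k$; otherwise replace the leftmost letter $x'>x$ of $r_k$ by $x$ and insert $x'$ by the same procedure into $(r_1,\dots,r_{k-1})$, keeping the modified bottom row below. Iterating gives $\mathcal{I}(T,w)$; the product is $T\ast T'=\mathcal{I}(T,\mathcal{R}(T'))$, associative with unit $\emptyset$. A braiding on a set $X$ is a map $\sigma\colon X^{\times2}\to X^{\times2}$ satisfying $(\sigma\times\mathrm{Id})(\mathrm{Id}\times\sigma)(\sigma\times\mathrm{Id})=(\mathrm{Id}\times\sigma)(\sigma\times\mathrm{Id})(\mathrm{Id}\times\sigma)$.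 A braided commutative monoid is a monoid $(M,\cdot,1)$ with a braiding $\sigma$ on $M$ such that for all $u,v,w\in M$: $\sigma(u\cdot v,w)=(w'',u'\cdot v')$ where $\sigma(v,w)=(w',v')$, $\sigma(u,w')=(w'',u')$; $\sigma(u,v\cdot w)=(v'\cdot w',u'')$ where $\sigma(u,v)=(v',u')$, $\sigma(u',w)=(w',u'')$; $w'\cdot v'=v\cdot w$ where $\sigma(v,w)=(w',v')$; and $\sigma(v,w)=(w,v)$ whenever $v=1$ or $w=1$. *)

theory Defs
  imports "HOL-Algebra.Group"
begin

section \<open>Young tableaux\<close>

text \<open>
  A tableau is the list of its rows from top to bottom, in French orientation: rows get
  longer, and their entries strictly smaller, on the way down.
\<close>

definition row_dom :: "'a::linorder list \<Rightarrow> 'a list \<Rightarrow> bool"  (infix \<open>\<succ>\<^sub>R\<close> 50) where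
  "xs \<succ>\<^sub>R ys \<longleftrightarrow> length xs \<le> length ys \<and> (\<forall>i<length xs. xs ! i > ys ! i)"

definition is_row :: "'a::linorder set \<Rightarrow> 'a list \<Rightarrow> bool" where
  "is_row A r \<longleftrightarrow> r \<in> lists A \<and> sorted r"

definition YT :: "'a::linorder set \<Rightarrow> 'a list list set" where
  "YT A = {T. (\<forall>r \<in> set T. is_row A r \<and> r \<noteq> []) \<and> successively (\<succ>\<^sub>R) T}"

definition rows :: "'a list list \<Rightarrow> nat" where
  "rows T = length T"

definition cols :: "'a list list \<Rightarrow> nat" where
  "cols T = (if T = [] then 0 else length (last T))"

text \<open>
  The rows being left-justified, the \<open>j\<close>-th column consists of the \<open>j\<close>-th entries of those
  rows that are long enough; \<^const>\<open>transpose\<close> lists exactly these columns, from left to right,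
  each one read from top to bottom.
\<close>

abbreviation columns :: "'a list list \<Rightarrow> 'a list list" where
  "columns T \<equiv> transpose T"

text \<open>Right Schensted insertion: it starts in the bottom row and bumps letters upwards.\<close>

function schensted_insert :: "'a::linorder list list \<Rightarrow> 'a \<Rightarrow> 'a list list" where
  "schensted_insert T x =
    (if T = [] then [[x]]
     else let U = butlast T; r = last T in
       if last r \<le> x then U @ [r @ [x]]
       else let i = (LEAST i. i < length r \<and> x < r ! i)
            in schensted_insert U (r ! i) @ [r[i := x]])"
  by pat_completeness auto
termination
  by (relation "measure (\<lambda>(T, x). length T)") auto

declare schensted_insert.simps [simp del]

definition tableau_mult :: "'a::linorder list list \<Rightarrow> 'a list list \<Rightarrow> 'a list list"
    (infixl \<open>\<ast>\<close> 70) where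
  "T \<ast> T' = foldl schensted_insert T (concat T')"

section \<open>Braided commutative monoids\<close>

definition on_12 :: "('a \<times> 'a \<Rightarrow> 'a \<times> 'a) \<Rightarrow> 'a \<times> 'a \<times> 'a \<Rightarrow> 'a \<times> 'a \<times> 'a" where
  "on_12 \<sigma> = (\<lambda>(x, y, z). let (x', y') = \<sigma> (x, y) in (x', y', z))"

definition on_23 :: "('a \<times> 'a \<Rightarrow> 'a \<times> 'a) \<Rightarrow> 'a \<times> 'a \<times> 'a \<Rightarrow> 'a \<times> 'a \<times> 'a" where
  "on_23 \<sigma> = (\<lambda>(x, y, z). let (y', z') = \<sigma> (y, z) in (x, y', z'))"

definition braiding :: "'a set \<Rightarrow> ('a \<times> 'a \<Rightarrow> 'a \<times> 'a) \<Rightarrow> bool" where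
  "braiding X \<sigma> \<longleftrightarrow>
    \<sigma> \<in> X \<times> X \<rightarrow> X \<times> X \<and>
    (\<forall>t \<in> X \<times> X \<times> X.
      on_12 \<sigma> (on_23 \<sigma> (on_12 \<sigma> t)) = on_23 \<sigma> (on_12 \<sigma> (on_23 \<sigma> t)))"

locale braided_commutative_monoid = monoid G for G (structure) +
  fixes \<sigma> :: "'a \<times> 'a \<Rightarrow> 'a \<times> 'a"
  assumes braiding: "braiding (carrier G) \<sigma>"
    and braid_mult_left:
      "\<lbrakk>u \<in> carrier G; v \<in> carrier G; w \<in> carrier G;
        \<sigma> (v, w) = (w', v'); \<sigma> (u, w') = (w'', u')\<rbrakk>
       \<Longrightarrow> \<sigma> (u \<otimes> v, w) = (w'', u' \<otimes> v')"
    and braid_mult_right: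
      "\<lbrakk>u \<in> carrier G; v \<in> carrier G; w \<in> carrier G;
        \<sigma> (u, v) = (v', u'); \<sigma> (u', w) = (w', u'')\<rbrakk>
       \<Longrightarrow> \<sigma> (u, v \<otimes> w) = (v' \<otimes> w', u'')"
    and braid_commute:
      "\<lbrakk>v \<in> carrier G; w \<in> carrier G; \<sigma> (v, w) = (w', v')\<rbrakk> \<Longrightarrow> w' \<otimes> v' = v \<otimes> w"
    and braid_one:
      "\<lbrakk>v \<in> carrier G; w \<in> carrier G; v = \<one> \<or> w = \<one>\<rbrakk> \<Longrightarrow> \<sigma> (v, w) = (w, v)"

section \<open>The two structures on tableaux with a counter\<close>

text \<open>
  The subtractions below are those of \<^typ>\<open>nat\<close>; that they never truncate on Young tableaux
  is part of what has to be shown for these products.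
\<close>

definition YT_R :: "'a::linorder set \<Rightarrow> ('a list list \<times> nat) monoid" where
  "YT_R A =
    \<lparr>carrier = YT A \<times> UNIV,
     mult = (\<lambda>(T1, a1) (T2, a2). (T1 \<ast> T2, a1 + a2 + rows T1 + rows T2 - rows (T1 \<ast> T2))),
     one = ([], 0)\<rparr>"

definition YT_C :: "'a::linorder set \<Rightarrow> ('a list list \<times> nat) monoid" where
  "YT_C A =
    \<lparr>carrier = YT A \<times> UNIV,
     mult = (\<lambda>(T1, a1) (T2, a2). (T1 \<ast> T2, a1 + a2 + cols T1 + cols T2 - cols (T1 \<ast> T2))),
     one = ([], 0)\<rparr>"

type_synonym 'a counted_pair = "('a list list \<times> nat) \<times> ('a list list \<times> nat)"

fun is_braid_R :: "'a::linorder set \<Rightarrow> 'a counted_pair \<Rightarrow> 'a counted_pair \<Rightarrow> bool" where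
  "is_braid_R A ((T1, a1), (T2, a2)) ((T2', a2'), (T1', a1')) \<longleftrightarrow>
    T1' \<in> YT A \<and> T2' \<in> YT A \<and>
    T2' @ T1' = T1 \<ast> T2 \<and>
    a1' + rows T1' = a1 + rows T1 \<and>
    a2' + rows T2' = a2 + rows T2 \<and>
    (a1' > 0 \<longleftrightarrow> rows (T1 \<ast> T2) < a1 + rows T1) \<and>
    (a1' > 0 \<longrightarrow> T2' = [])"

fun is_braid_C :: "'a::linorder set \<Rightarrow> 'a counted_pair \<Rightarrow> 'a counted_pair \<Rightarrow> bool" where
  "is_braid_C A ((T1, a1), (T2, a2)) ((T2', a2'), (T1', a1')) \<longleftrightarrow>
    T1' \<in> YT A \<and> T2' \<in> YT A \<and>
    columns T2' @ columns T1' = columns (T1 \<ast> T2) \<and>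
    a1' + cols T1' = a1 + cols T1 \<and>
    a2' + cols T2' = a2 + cols T2 \<and>
    (a2' > 0 \<longleftrightarrow> cols (T1 \<ast> T2) < a2 + cols T2) \<and>
    (a2' > 0 \<longrightarrow> T1' = [])"

definition braid_R :: "'a::linorder set \<Rightarrow> 'a counted_pair \<Rightarrow> 'a counted_pair"  (\<open>\<sigma>\<^sub>R\<close>) where
  "\<sigma>\<^sub>R A p = (THE q. is_braid_R A p q)"

definition braid_C :: "'a::linorder set \<Rightarrow> 'a counted_pair \<Rightarrow> 'a counted_pair"  (\<open>\<sigma>\<^sub>C\<close>) where
  "\<sigma>\<^sub>C A p = (THE q. is_braid_C A p q)"

end

theory Submission
  imports Defs "HOL-Library.Sublist"
begin

text \<open>
  A pair \<open>(T, a)\<close> is a tableau padded with \<open>a\<close> empty rows, that is, a chain of rows for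
  \<open>\<succ>\<^sub>R\<close> of prescribed length. Within its plactic class and its length, such a chain is unique
  (row insertion respects the Knuth relations and splits off the bottom row), and it exists
  because two adjacent rows can be merged. The product normalises a concatenation, and the
  braiding normalises it and cuts the result again. All axioms then follow if multiplying a
  chain on the right, respectively on the left, by a word only sends a word of the same length
  through its bottom, respectively top, part; for lists of three rows this is a comparison of
  letters. Columns obey the same argument: reversing words exchanges the Knuth relations once
  strict and weak inequalities are exchanged, which is what transposing a tableau does.
\<close>

section \<open>Braidings from normal forms\<close>

text \<open>The number of rows is not additive under the product of tableaux, so a product may have
  too few rows to be cut into two pieces of the sizes of its factors. Counting empty rows restores
  additivity. The braiding then returns pieces whose lengths are those of the arguments, exchanged,
  and both sides of the Yang-Baxter equation cut chains of one length and one plactic class at the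
  same two places. What is left is whether pieces computed separately fit together, and this
  concerns only the two entries that meet at a seam. That is why a condition on three entries is
  enough. The empty row dominates every row and is dominated only by itself. Hence padding gathers
  at one end, and a chain of given length carries the same information as a tableau with a
  counter.\<close>

text \<open>
  A list over \<open>E\<close> is in normal form if adjacent entries are related by \<open>dom\<close>; \<open>K\<close> is the
  congruence to be solved. The last two assumptions are the two halves of the confluence of
  rewriting lists of length three, that is, of the Yang--Baxter equation for the two-entry
  normalisation.
\<close>

locale normal_forms =
  fixes E :: "'e \<Rightarrow> bool" and dom :: "'e \<Rightarrow> 'e \<Rightarrow> bool" and K :: "'e list \<Rightarrow> 'e list \<Rightarrow> bool"
  assumes K_refl: "K xs xs"
    and K_sym: "K xs ys \<Longrightarrow> K ys xs"
    and K_trans [trans]: "K xs ys \<Longrightarrow> K ys zs \<Longrightarrow> K xs zs"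
    and K_append: "K xs xs' \<Longrightarrow> K ys ys' \<Longrightarrow> K (xs @ ys) (xs' @ ys')"
    and merge_exists: "E a \<Longrightarrow> E b \<Longrightarrow> \<exists>t c. E t \<and> E c \<and> dom t c \<and> K [t, c] [a, b]"
    and unique:
      "\<lbrakk>list_all E xs; successively dom xs; list_all E ys; successively dom ys;
        length xs = length ys; K xs ys\<rbrakk> \<Longrightarrow> xs = ys"
    and dom_right:
      "\<lbrakk>E t; E b; E r; E b'; E b''; E t'; E m; dom t b;
        dom b' b''; K [b', b''] [b, r]; dom t' m; K [t', m] [t, b']\<rbrakk> \<Longrightarrow> dom m b''"
    and dom_left:
      "\<lbrakk>E t; E b; E r; E t'; E m; E m'; E b'; dom t b;
        dom t' m; K [t', m] [r, t]; dom m' b'; K [m', b'] [m, b]\<rbrakk> \<Longrightarrow> dom t' m'"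
begin

section \<open>Chains, and their construction by pushing entries through them\<close>

definition chain :: "'e list \<Rightarrow> bool" where
  "chain xs \<longleftrightarrow> list_all E xs \<and> successively dom xs"

lemma chain_Nil [simp]: "chain []"
  by (simp add: chain_def)

lemma chain_Cons: "chain (x # xs) \<longleftrightarrow> E x \<and> chain xs \<and> (xs \<noteq> [] \<longrightarrow> dom x (hd xs))"
  by (auto simp: chain_def successively_Cons)

lemma chain_append:
  "chain (xs @ ys) \<longleftrightarrow> chain xs \<and> chain ys \<and> (xs \<noteq> [] \<longrightarrow> ys \<noteq> [] \<longrightarrow> dom (last xs) (hd ys))"
  by (auto simp: chain_def successively_append_iff)

lemma chain_unique: "\<lbrakk>chain xs; chain ys; length xs = length ys; K xs ys\<rbrakk> \<Longrightarrow> xs = ys"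
  by (auto simp: chain_def intro: unique)

definition merge_pair :: "'e \<Rightarrow> 'e \<Rightarrow> 'e \<times> 'e" where
  "merge_pair a b = (SOME (t, c). E t \<and> E c \<and> dom t c \<and> K [t, c] [a, b])"

lemma merge_pair:
  assumes "E a" "E b" "merge_pair a b = (t, c)"
  shows "E t" "E c" "dom t c" "K [t, c] [a, b]"
proof -
  have "\<exists>p. case p of (t, c) \<Rightarrow> E t \<and> E c \<and> dom t c \<and> K [t, c] [a, b]"
    using merge_exists[OF assms(1,2)] by auto
  from someI_ex[OF this, folded merge_pair_def] assms(3)
  show "E t" "E c" "dom t c" "K [t, c] [a, b]" by auto
qed

text \<open>
  \<open>push c a\<close> moves \<open>a\<close> leftwards through \<open>c\<close>; the second component is what is left behind.
\<close>

primrec push :: "'e list \<Rightarrow> 'e \<Rightarrow> 'e \<times> 'e list" where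
  "push [] a = (a, [])"
| "push (b # c) a = (let (x, d) = push c a; (t, y) = merge_pair b x in (t, y # d))"

lemma push_append:
  "push (c1 @ c2) a = (let (x, d) = push c2 a; (t, e) = push c1 x in (t, e @ d))"
  by (induction c1) (auto simp: split: prod.splits)

lemma push_properties:
  assumes "list_all E c" "E a" "push c a = (x, d)"
  shows "E x \<and> list_all E d \<and> length d = length c \<and> K (x # d) (c @ [a])"
  using assms
proof (induction c arbitrary: x d)
  case Nil
  then show ?case by (auto intro: K_refl)
next
  case (Cons b c)
  obtain z e where ze: "push c a = (z, e)" by fastforce
  obtain t y where ty: "merge_pair b z = (t, y)" by fastforce
  from Cons ze have IH: "E z" "list_all E e" "length e = length c" "K (z # e) (c @ [a])" and "E b"
    by auto
  note m = merge_pair[OF \<open>E b\<close> \<open>E z\<close> ty]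
  have "K ([t, y] @ e) ([b, z] @ e)" by (rule K_append[OF m(4) K_refl])
  also have "K ([b, z] @ e) ([b] @ c @ [a])" using K_append[OF K_refl IH(4), of "[b]"] by simp
  finally show ?case using Cons.prems ze ty m IH by auto
qed

text \<open>A seam of the new list lies between what two neighbours \<open>b\<close> and
  \<open>b2\<close> leave behind. This is the situation of \<open>dom_right\<close>:
  \<open>b2\<close> was merged with the arriving entry \<open>z2\<close> and sent \<open>z\<close>
  on to \<open>b\<close>.\<close>

lemma chain_push:
  assumes "chain c" "E a" "push c a = (x, d)"
  shows "chain (x # d)"
  using assms
proof (induction c arbitrary: x d)
  case Nil
  then show ?case by (simp add: chain_Cons)
next
  case (Cons b c)
  obtain z e where ze: "push c a = (z, e)" by fastforce
  obtain t y where ty: "merge_pair b z = (t, y)" by fastforce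
  have b: "E b" and c: "chain c" using Cons.prems by (auto simp: chain_Cons)
  have IH: "chain (z # e)" using Cons.IH[OF c \<open>E a\<close> ze] .
  then have z: "E z" by (simp add: chain_Cons)
  note m = merge_pair[OF b z ty]
  have "dom y (hd e)" if "e \<noteq> []"
  proof (cases c)
    case Nil
    with ze that show ?thesis by simp
  next
    case (Cons b2 c2)
    obtain z2 e2 where ze2: "push c2 a = (z2, e2)" by fastforce
    obtain t2 y2 where ty2: "merge_pair b2 z2 = (t2, y2)" by fastforce
    have e: "t2 = z" "e = y2 # e2" using ze ze2 ty2 Cons by auto
    have b2: "E b2" "chain c2" "dom b b2"
      using \<open>chain (b # c)\<close> Cons by (auto simp: chain_Cons)
    have "E z2" using push_properties[OF _ \<open>E a\<close> ze2] b2 by (simp add: chain_def)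
    note m2 = merge_pair[OF \<open>E b2\<close> this ty2]
    show ?thesis
      using dom_right[OF b \<open>E b2\<close> \<open>E z2\<close> m2(1,2) m(1,2) b2(3) m2(3,4) m(3)] m(4) e by simp
  qed
  then show ?case using Cons.prems ze ty m IH by (auto simp: chain_Cons)
qed

text \<open>An emitted entry leaves for good: later entries pass only through the remainder, which
  keeps the length of \<open>c\<close>. The emitted list is in general not a chain.\<close>

primrec pushes :: "'e list \<Rightarrow> 'e list \<Rightarrow> 'e list \<times> 'e list" where
  "pushes c [] = ([], c)"
| "pushes c (a # as) = (let (x, d) = push c a; (xs, d') = pushes d as in (x # xs, d'))"

lemma pushes_properties:
  assumes "list_all E c" "list_all E as" "pushes c as = (xs, d)"
  shows "list_all E xs \<and> list_all E d \<and> length xs = length as \<and> length d = length c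
    \<and> K (xs @ d) (c @ as)"
  using assms
proof (induction as arbitrary: c xs d)
  case Nil
  then show ?case by (auto intro: K_refl)
next
  case (Cons a as)
  obtain z e where ze: "push c a = (z, e)" by fastforce
  obtain ys d' where ys: "pushes e as = (ys, d')" by fastforce
  from Cons.prems have a: "E a" "list_all E as" by auto
  note p = push_properties[OF Cons.prems(1) a(1) ze]
  with Cons.IH[OF _ a(2) ys]
  have IH: "list_all E ys" "list_all E d'" "length ys = length as" "length d' = length e"
    "K (ys @ d') (e @ as)" by auto
  have "K ([z] @ ys @ d') ([z] @ e @ as)" by (rule K_append[OF K_refl IH(5)])
  also have "K ([z] @ e @ as) (c @ a # as)"
    using K_append[of "z # e" "c @ [a]" as as] p K_refl by auto
  finally show ?case using Cons.prems ze ys IH p by auto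
qed

text \<open>In contrast to \<open>pushes\<close>, the emitted entry stays in front and the next
  entry passes through it as well; the chain grows by one each time.\<close>

lemma chain_exists_append:
  assumes "chain c" "list_all E as"
  shows "\<exists>ys. chain ys \<and> length ys = length c + length as \<and> K ys (c @ as)"
  using assms
proof (induction as arbitrary: c)
  case Nil
  then show ?case by (auto intro: K_refl)
next
  case (Cons a as)
  obtain z e where ze: "push c a = (z, e)" by fastforce
  from Cons.prems have a: "E a" "list_all E as" by auto
  note p = push_properties[OF _ a(1) ze] chain_push[OF Cons.prems(1) a(1) ze]
  then obtain ys where ys: "chain ys" "length ys = length (z # e) + length as" "K ys (z # e @ as)"
    using Cons.IH[of "z # e"] a by auto
  note ys(3)
  also have "K (z # e @ as) (c @ a # as)"
    using K_append[of "z # e" "c @ [a]" as as] p Cons.prems K_refl by (auto simp: chain_def)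
  finally show ?case using ys p Cons.prems by (auto simp: chain_def)
qed

lemma chain_exists: "list_all E as \<Longrightarrow> \<exists>ys. chain ys \<and> length ys = length as \<and> K ys as"
  using chain_exists_append[of "[]" as] by simp

text \<open>Pushing \<open>a\<close> through \<open>c1 @ c2\<close> means pushing it through
  \<open>c2\<close> and the emitted entry through \<open>c1\<close>, so \<open>c2\<close> evolves
  independently of \<open>c1\<close>. In the induction \<open>t # g\<close> takes the place of
  \<open>c1\<close> and \<open>f\<close> that of \<open>c2\<close>; when no entry is left,
  uniqueness identifies \<open>e\<close> with the front part.\<close>

lemma chain_pushes:
  assumes "chain (c1 @ c2)" "list_all E as" "pushes c2 as = (xs, d)"
    and "chain e" "length e = length c1 + length as" "K e (c1 @ xs)"
  shows "chain (e @ d)"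
  using assms
proof (induction as arbitrary: c1 c2 xs d)
  case Nil
  then show ?case using chain_unique[of e c1] by (auto simp: chain_append)
next
  case (Cons a as)
  obtain z f where zf: "push c2 a = (z, f)" by fastforce
  obtain t g where tg: "push c1 z = (t, g)" by fastforce
  obtain ys d' where ys: "pushes f as = (ys, d')" by fastforce
  have eq: "xs = z # ys" "d = d'" using Cons.prems zf ys by auto
  from Cons.prems have a: "E a" "list_all E as" by auto
  have c: "chain c1" "chain c2" using Cons.prems by (auto simp: chain_append)
  then have "list_all E c1" "list_all E c2" by (auto simp: chain_def)
  note p = push_properties[OF this(2) a(1) zf]
  then have q: "length g = length c1" "K (t # g) (c1 @ [z])"
    using push_properties[OF \<open>list_all E c1\<close> _ tg] by auto
  have "push (c1 @ c2) a = (t, g @ f)" using zf tg by (simp add: push_append)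
  from chain_push[OF Cons.prems(1) a(1) this] have ch: "chain ((t # g) @ f)" by simp
  have "K (c1 @ xs) ((t # g) @ ys)"
    using K_append[OF K_sym[OF q(2)] K_refl[of ys]] eq by simp
  with Cons.prems(6) have "K e ((t # g) @ ys)" by (rule K_trans)
  from Cons.IH[OF ch a(2) ys Cons.prems(4) _ this] show ?case using Cons.prems q eq by simp
qed

text \<open>What \<open>pushes\<close> emits has \<open>xs\<close> as its normal form, by
  uniqueness. Since \<open>e\<close> depends only on the class of \<open>c1 @ xs\<close>, it makes
  no difference whether the emitted word is normalised before it meets \<open>c1\<close>.\<close>

lemma chain_right:
  assumes "chain (c1 @ c2)" "list_all E as"
    and "chain (xs @ d)" "K (xs @ d) (c2 @ as)" "length xs = length as" "length d = length c2"
    and "chain e" "length e = length c1 + length xs" "K e (c1 @ xs)"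
  shows "chain (e @ d)"
proof -
  obtain ys d' where ys: "pushes c2 as = (ys, d')" by fastforce
  have c2: "chain c2" "list_all E c2" using assms(1) by (auto simp: chain_def successively_append_iff)
  note p = pushes_properties[OF c2(2) assms(2) ys]
  then obtain f where f: "chain f" "length f = length ys" "K f ys" using chain_exists by blast
  have ch: "chain (f @ d')"
    using chain_pushes[of "[]" c2 as ys d' f] c2 assms(2) ys f p by simp
  have "K (f @ d') (ys @ d')" using K_append[OF f(3) K_refl] .
  also have "K (ys @ d') (xs @ d)" using p assms(4) K_sym K_trans by blast
  finally have "f @ d' = xs @ d"
    using chain_unique ch assms(3,5,6) f(2) p by simp
  then have eq: "f = xs" "d' = d" using f(2) p assms(5) by auto
  have "K (c1 @ xs) (c1 @ ys)" using K_append[OF K_refl f(3)] eq by simp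
  with assms(9) have "K e (c1 @ ys)" by (rule K_trans)
  with chain_pushes[OF assms(1,2) ys assms(7)] show ?thesis using assms eq by simp
qed

text \<open>The braiding in terms of normal forms: the product is cut after as many entries as the
  right factor has.\<close>

definition is_split :: "'e list \<Rightarrow> 'e list \<Rightarrow> 'e list \<Rightarrow> 'e list \<Rightarrow> bool" where
  "is_split xs ys us vs \<longleftrightarrow> length us = length ys \<and> length vs = length xs \<and>
    chain (us @ vs) \<and> K (us @ vs) (xs @ ys)"

lemma split_exists:
  assumes "chain xs" "chain ys"
  obtains us vs where "is_split xs ys us vs"
proof -
  have "list_all E (xs @ ys)" using assms by (simp add: chain_def)
  then obtain zs where "chain zs" "length zs = length (xs @ ys)" "K zs (xs @ ys)"
    using chain_exists by blast
  then have "is_split xs ys (take (length ys) zs) (drop (length ys) zs)"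
    by (simp add: is_split_def)
  then show thesis by (rule that)
qed

lemma split_unique: "\<lbrakk>is_split xs ys us vs; is_split xs ys us' vs'\<rbrakk> \<Longrightarrow> us = us' \<and> vs = vs'"
  using chain_unique[of "us @ vs" "us' @ vs'"] K_trans[of "us @ vs" "xs @ ys" "us' @ vs'"] K_sym
  by (simp add: is_split_def)

text \<open>Reading lists from right to left exchanges \<open>dom_right\<close> and
  \<open>dom_left\<close>, so results on multiplication from the right have mirror images.\<close>

lemma dual: "normal_forms E (\<lambda>x y. dom y x) (\<lambda>xs ys. K (rev xs) (rev ys))"
proof (rule normal_forms.intro, goal_cases)
  case (5 a b)
  then obtain t c where "E t \<and> E c \<and> dom t c \<and> K [t, c] [b, a]" using merge_exists by blast
  then show ?case by auto
next
  case (6 xs ys)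
  then show ?case using unique[of "rev xs" "rev ys"] by simp
next
  case (7 t b r b' b'' t' m)
  then show ?case using dom_left[of b t r b'' b' m t'] by simp
next
  case (8 t b r t' m m' b')
  then show ?case using dom_right[of b t r m t' b' m'] by simp
qed (blast intro: K_refl, blast intro: K_sym, erule K_trans, assumption, simp add: K_append)

lemma chain_left:
  assumes "chain (c1 @ c2)" "list_all E as"
    and "chain (d @ xs)" "K (d @ xs) (as @ c1)" "length xs = length as" "length d = length c1"
    and "chain e" "length e = length xs + length c2" "K e (xs @ c2)"
  shows "chain (d @ e)"
proof -
  interpret op: normal_forms E "\<lambda>x y. dom y x" "\<lambda>xs ys. K (rev xs) (rev ys)" by (rule dual)
  have op_chain: "op.chain (rev zs) = chain zs" for zs
    by (simp add: op.chain_def chain_def)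
  have "op.chain (rev e @ rev d)"
    using op.chain_right[of "rev c2" "rev c1" "rev as" "rev xs" "rev d" "rev e"] assms
    by (simp add: op_chain flip: rev_append)
  then show ?thesis by (simp add: op_chain flip: rev_append)
qed

text \<open>Meant for \<open>f = rev\<close>, which turns a row into a column read
  downwards.\<close>

lemma transport:
  assumes "bij f"
  shows "normal_forms (\<lambda>x. E (f x)) (\<lambda>x y. dom (f x) (f y)) (\<lambda>xs ys. K (map f xs) (map f ys))"
proof (rule normal_forms.intro, goal_cases)
  case (5 a b)
  then obtain t c where "E t" "E c" "dom t c" "K [t, c] [f a, f b]" using merge_exists by blast
  moreover obtain t' c' where "t = f t'" "c = f c'" using bij_is_surj[OF assms] by (meson surjE)
  ultimately show ?case by auto
next
  case (6 xs ys)
  then have "map f xs = map f ys"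
    by (intro unique) (auto simp: list_all_iff successively_map)
  then show ?case using bij_is_inj[OF assms] by simp
next
  case (7 t b r b' b'' t' m)
  then show ?case using dom_right[of "f t" "f b" "f r" "f b'" "f b''" "f t'" "f m"] by simp
next
  case (8 t b r t' m m' b')
  then show ?case using dom_left[of "f t" "f b" "f r" "f t'" "f m" "f m'" "f b'"] by simp
qed (blast intro: K_refl, blast intro: K_sym, erule K_trans, assumption, simp add: K_append)

text \<open>An encoding is determined by its length and its class, so each axiom compares two chains
  in the class of the concatenated encodings. Lengths and classes agree by the assumptions on
  product and braiding; where lists are glued, \<open>chain_right\<close> or
  \<open>chain_left\<close> supplies the seam.\<close>

lemma braided_commutative_monoidI:
  fixes G (structure) and \<sigma> :: "'x \<times> 'x \<Rightarrow> 'x \<times> 'x" and enc :: "'x \<Rightarrow> 'e list"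
  assumes inj: "inj_on enc (carrier G)"
    and chain_enc: "\<And>x. x \<in> carrier G \<Longrightarrow> chain (enc x)"
    and one: "\<one> \<in> carrier G" "enc \<one> = []"
    and mult: "\<And>x y. x \<in> carrier G \<Longrightarrow> y \<in> carrier G \<Longrightarrow>
      x \<otimes> y \<in> carrier G \<and> length (enc (x \<otimes> y)) = length (enc x) + length (enc y) \<and>
      K (enc (x \<otimes> y)) (enc x @ enc y)"
    and split: "\<And>x y x' y'. x \<in> carrier G \<Longrightarrow> y \<in> carrier G \<Longrightarrow> \<sigma> (x, y) = (y', x') \<Longrightarrow>
      x' \<in> carrier G \<and> y' \<in> carrier G \<and> is_split (enc x) (enc y) (enc y') (enc x')"
  shows "braided_commutative_monoid G \<sigma>"
proof -
  note braid = split[unfolded is_split_def]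
  have eqI: "x = y" if "x \<in> carrier G" "y \<in> carrier G" "length (enc x) = length (enc y)"
    "K (enc x) (enc y)" for x y
    using that chain_unique[of "enc x" "enc y"] chain_enc inj by (auto dest: inj_onD)
  have eq_pairI: "x = x' \<and> y = y'"
    if "x \<in> carrier G" "y \<in> carrier G" "x' \<in> carrier G" "y' \<in> carrier G"
      "length (enc x) = length (enc x')" "length (enc y) = length (enc y')"
      "chain (enc x @ enc y)" "chain (enc x' @ enc y')" "K (enc x @ enc y) (enc x' @ enc y')"
    for x x' y y'
    using that chain_unique[of "enc x @ enc y" "enc x' @ enc y'"] inj by (auto dest: inj_onD)
  have E_enc: "list_all E (enc x)" if "x \<in> carrier G" for x
    using chain_enc[OF that] by (simp add: chain_def)
  show ?thesis
  proof (unfold_locales)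
    fix x y assume "x \<in> carrier G" "y \<in> carrier G"
    then show "x \<otimes> y \<in> carrier G" using mult by blast
  next
    fix x y z assume c: "x \<in> carrier G" "y \<in> carrier G" "z \<in> carrier G"
    have "K (enc ((x \<otimes> y) \<otimes> z)) (enc (x \<otimes> y) @ enc z)" using c mult by blast
    also have "K \<dots> ((enc x @ enc y) @ enc z)" using c mult by (blast intro: K_append K_refl)
    also have "(enc x @ enc y) @ enc z = enc x @ enc y @ enc z" by simp
    also have "K \<dots> (enc x @ enc (y \<otimes> z))" using c mult by (blast intro: K_append K_refl K_sym)
    also have "K \<dots> (enc (x \<otimes> (y \<otimes> z)))" using c mult by (blast intro: K_sym)
    finally show "(x \<otimes> y) \<otimes> z = x \<otimes> (y \<otimes> z)" using c mult by (intro eqI) auto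
  next
    show "\<one> \<in> carrier G" by (rule one)
  next
    fix x assume "x \<in> carrier G"
    then show "\<one> \<otimes> x = x" "x \<otimes> \<one> = x"
      using mult[of \<one> x] mult[of x \<one>] one by (auto intro: eqI)
  next
    have "on_12 \<sigma> (on_23 \<sigma> (on_12 \<sigma> (u, v, w))) = on_23 \<sigma> (on_12 \<sigma> (on_23 \<sigma> (u, v, w)))"
      if c: "u \<in> carrier G" "v \<in> carrier G" "w \<in> carrier G" for u v w
    proof -
      obtain v1 u1 where s1: "\<sigma> (u, v) = (v1, u1)" by fastforce
      note b1 = braid[OF c(1,2) s1]
      then have c1: "v1 \<in> carrier G" "u1 \<in> carrier G" by auto
      obtain w1 u2 where s2: "\<sigma> (u1, w) = (w1, u2)" by fastforce
      note b2 = braid[OF c1(2) c(3) s2]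
      then have c2: "w1 \<in> carrier G" "u2 \<in> carrier G" by auto
      obtain w2 v2 where s3: "\<sigma> (v1, w1) = (w2, v2)" by fastforce
      note b3 = braid[OF c1(1) c2(1) s3]
      \<comment> \<open>The pair \<open>v1\<close>, \<open>u1\<close> is already a chain when
        \<open>w\<close> arrives from the right, and \<open>u1\<close> passes \<open>w1\<close> on
        to \<open>v1\<close>.\<close>
      have ch: "chain ((enc w2 @ enc v2) @ enc u2)"
        by (rule chain_right[of "enc v1" "enc u1" "enc w" "enc w1"]) (use b1 b2 b3 E_enc c in auto)
      have "K (enc w2 @ enc v2 @ enc u2) ((enc v1 @ enc w1) @ enc u2)"
        using K_append[OF _ K_refl] b3 by fastforce
      also have "K ((enc v1 @ enc w1) @ enc u2) (enc v1 @ enc u1 @ enc w)"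
        using K_append[OF K_refl] b2 by fastforce
      also have "K (enc v1 @ enc u1 @ enc w) (enc u @ enc v @ enc w)"
        using K_append[OF _ K_refl, of "enc v1 @ enc u1" "enc u @ enc v" "enc w"] b1 by simp
      finally have k: "K (enc w2 @ enc v2 @ enc u2) (enc u @ enc v @ enc w)" .

      obtain w1' v1' where t1: "\<sigma> (v, w) = (w1', v1')" by fastforce
      note d1 = braid[OF c(2,3) t1]
      then have e1: "w1' \<in> carrier G" "v1' \<in> carrier G" by auto
      obtain w2' u1' where t2: "\<sigma> (u, w1') = (w2', u1')" by fastforce
      note d2 = braid[OF c(1) e1(1) t2]
      then have e2: "w2' \<in> carrier G" "u1' \<in> carrier G" by auto
      obtain v2' u2' where t3: "\<sigma> (u1', v1') = (v2', u2')" by fastforce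
      note d3 = braid[OF e2(2) e1(2) t3]
      \<comment> \<open>The mirror image: \<open>w1'\<close>, \<open>v1'\<close> is already a chain
        when \<open>u\<close> arrives from the left, and \<open>w1'\<close> passes
        \<open>u1'\<close> on to \<open>v1'\<close>.\<close>
      have ch': "chain (enc w2' @ enc v2' @ enc u2')"
        by (rule chain_left[of "enc w1'" "enc v1'" "enc u" _ "enc u1'"]) (use d1 d2 d3 E_enc c in auto)
      have "K (enc w2' @ enc v2' @ enc u2') (enc w2' @ enc u1' @ enc v1')"
        using K_append[OF K_refl] d3 by blast
      also have "K (enc w2' @ enc u1' @ enc v1') ((enc u @ enc w1') @ enc v1')"
        using K_append[OF _ K_refl, of "enc w2' @ enc u1'" "enc u @ enc w1'" "enc v1'"] d2 by simp
      also have "K ((enc u @ enc w1') @ enc v1') (enc u @ enc v @ enc w)"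
        using K_append[OF K_refl] d1 by fastforce
      finally have k': "K (enc w2' @ enc v2' @ enc u2') (enc u @ enc v @ enc w)" .

      have "K (enc w2 @ enc v2 @ enc u2) (enc w2' @ enc v2' @ enc u2')"
        using k K_sym[OF k'] by (rule K_trans)
      then have "enc w2 @ enc v2 @ enc u2 = enc w2' @ enc v2' @ enc u2'"
        using ch ch' b1 b2 b3 d1 d2 d3 by (intro chain_unique) auto
      then have "enc w2 = enc w2' \<and> enc v2 = enc v2' \<and> enc u2 = enc u2'"
        using b1 b2 b3 d1 d2 d3 by simp
      then have "w2 = w2' \<and> v2 = v2' \<and> u2 = u2'"
        using b2 b3 d2 d3 by (intro conjI inj_onD[OF inj]) simp_all
      then show ?thesis by (simp add: on_12_def on_23_def s1 s2 s3 t1 t2 t3)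
    qed
    moreover have "\<sigma> \<in> carrier G \<times> carrier G \<rightarrow> carrier G \<times> carrier G"
    proof (rule funcsetI, clarify)
      fix x y assume "x \<in> carrier G" "y \<in> carrier G"
      moreover obtain y' x' where s: "\<sigma> (x, y) = (y', x')" by fastforce
      ultimately show "\<sigma> (x, y) \<in> carrier G \<times> carrier G" using braid[OF _ _ s] by simp
    qed
    ultimately show "braiding (carrier G) \<sigma>" by (auto simp: braiding_def)
  next
    fix u v w w' v' w'' u'
    assume c: "u \<in> carrier G" "v \<in> carrier G" "w \<in> carrier G"
      and s1: "\<sigma> (v, w) = (w', v')" and s2: "\<sigma> (u, w') = (w'', u')"
    note b1 = braid[OF c(2,3) s1]
    then have c1: "v' \<in> carrier G" "w' \<in> carrier G" by auto
    note b2 = braid[OF c(1) c1(2) s2]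
    have m: "u \<otimes> v \<in> carrier G" "u' \<otimes> v' \<in> carrier G" using c c1 b2 mult by auto
    obtain p q where s: "\<sigma> (u \<otimes> v, w) = (p, q)" by fastforce
    note b = braid[OF m(1) c(3) s]
    have ch: "chain (enc w'' @ enc (u' \<otimes> v'))"
      by (rule chain_left[of "enc w'" "enc v'" "enc u" _ "enc u'"])
        (use b1 b2 E_enc c mult m chain_enc in auto)
    have "K (enc p @ enc q) (enc (u \<otimes> v) @ enc w)" using b by blast
    also have "K \<dots> ((enc u @ enc v) @ enc w)" using mult c K_append[OF _ K_refl] by blast
    also have "K ((enc u @ enc v) @ enc w) (enc u @ enc w' @ enc v')"
      using b1 K_append[OF K_refl] K_sym by fastforce
    also have "K (enc u @ enc w' @ enc v') ((enc w'' @ enc u') @ enc v')"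
      using K_append[OF K_sym[of "enc w'' @ enc u'" "enc u @ enc w'"] K_refl[of "enc v'"]] b2 by simp
    also have "K ((enc w'' @ enc u') @ enc v') (enc w'' @ enc (u' \<otimes> v'))"
      using b2 c1 mult[of u' v'] K_append[OF K_refl] K_sym by simp
    finally have "p = w'' \<and> q = u' \<otimes> v'"
      using b b1 b2 m mult c c1 ch by (intro eq_pairI) auto
    then show "\<sigma> (u \<otimes> v, w) = (w'', u' \<otimes> v')" using s by simp
  next
    fix u v w v' u' w' u''
    assume c: "u \<in> carrier G" "v \<in> carrier G" "w \<in> carrier G"
      and s1: "\<sigma> (u, v) = (v', u')" and s2: "\<sigma> (u', w) = (w', u'')"
    note b1 = braid[OF c(1,2) s1]
    then have c1: "v' \<in> carrier G" "u' \<in> carrier G" by auto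
    note b2 = braid[OF c1(2) c(3) s2]
    have m: "v \<otimes> w \<in> carrier G" "v' \<otimes> w' \<in> carrier G" using c c1 b2 mult by auto
    obtain p q where s: "\<sigma> (u, v \<otimes> w) = (p, q)" by fastforce
    note b = braid[OF c(1) m(1) s]
    have ch: "chain (enc (v' \<otimes> w') @ enc u'')"
      by (rule chain_right[of "enc v'" "enc u'" "enc w" "enc w'"])
        (use b1 b2 E_enc c c1 mult m chain_enc in auto)
    have "K (enc p @ enc q) (enc u @ enc (v \<otimes> w))" using b by blast
    also have "K \<dots> (enc u @ enc v @ enc w)" using mult c K_append[OF K_refl] by blast
    also have "K (enc u @ enc v @ enc w) ((enc v' @ enc u') @ enc w)"
      using K_append[OF K_sym[of "enc v' @ enc u'" "enc u @ enc v"] K_refl[of "enc w"]] b1 by simp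
    also have "K ((enc v' @ enc u') @ enc w) (enc v' @ enc w' @ enc u'')"
      using b2 K_append[OF K_refl] K_sym by simp
    also have "K (enc v' @ enc w' @ enc u'') (enc (v' \<otimes> w') @ enc u'')"
      using K_append[OF K_sym[of "enc (v' \<otimes> w')" "enc v' @ enc w'"] K_refl[of "enc u''"]]
        b2 c1 mult[of v' w'] by simp
    finally have "p = v' \<otimes> w' \<and> q = u''"
      using b b1 b2 m mult c c1 ch by (intro eq_pairI) auto
    then show "\<sigma> (u, v \<otimes> w) = (v' \<otimes> w', u'')" using s by simp
  next
    fix v w w' v'
    assume c: "v \<in> carrier G" "w \<in> carrier G" and s: "\<sigma> (v, w) = (w', v')"
    note b = braid[OF c s]
    have "K (enc (w' \<otimes> v')) (enc w' @ enc v')" using b mult by blast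
    also have "K \<dots> (enc v @ enc w)" using b by blast
    also have "K \<dots> (enc (v \<otimes> w))" using c mult K_sym by blast
    finally show "w' \<otimes> v' = v \<otimes> w" using b c mult by (intro eqI) auto
  next
    fix v w
    assume c: "v \<in> carrier G" "w \<in> carrier G" and "v = \<one> \<or> w = \<one>"
    obtain w' v' where s: "\<sigma> (v, w) = (w', v')" by fastforce
    note b = braid[OF c s]
    have "w' = w \<and> v' = v"
      using b c \<open>v = \<one> \<or> w = \<one>\<close> one chain_enc by (intro eq_pairI) auto
    then show "\<sigma> (v, w) = (w, v)" using s by simp
  qed
qed

end

section \<open>Rows and the plactic congruence\<close>

text \<open>
  Transposition exchanges weak and strict inequalities. To treat rows and columns at once, the
  parameter \<open>s\<close> selects the order along a row, and \<open>\<not> s\<close> the order across rows.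
\<close>

definition leq :: "bool \<Rightarrow> 'a::linorder \<Rightarrow> 'a \<Rightarrow> bool" where
  "leq s x y \<longleftrightarrow> x < y \<or> s \<and> x = y"

lemma not_leq: "\<not> leq (\<not> s) x y \<longleftrightarrow> leq s y x" "\<not> leq s x y \<longleftrightarrow> leq (\<not> s) y x"
  by (auto simp: leq_def)

lemma leq_D: "leq s x y \<Longrightarrow> \<not> leq (\<not> s) y x"
  by (simp add: not_leq)

lemma leq_trans: "leq s x y \<Longrightarrow> leq s y z \<Longrightarrow> leq s x z"
  by (auto simp: leq_def)

lemma leq_trans_mixed:
  "leq s x y \<Longrightarrow> leq (\<not> s) y z \<Longrightarrow> leq s' x z" "leq (\<not> s) x y \<Longrightarrow> leq s y z \<Longrightarrow> leq s' x z"
  by (auto simp: leq_def)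

abbreviation row :: "bool \<Rightarrow> 'a::linorder list \<Rightarrow> bool" where
  "row s \<equiv> sorted_wrt (leq s)"

fun dominates :: "bool \<Rightarrow> 'a::linorder list \<Rightarrow> 'a list \<Rightarrow> bool" where
  "dominates s [] b \<longleftrightarrow> True"
| "dominates s (x # t) [] \<longleftrightarrow> False"
| "dominates s (x # t) (y # b) \<longleftrightarrow> leq (\<not> s) y x \<and> dominates s t b"

lemma dominates_iff_nth:
  "dominates s t b \<longleftrightarrow> length t \<le> length b \<and> (\<forall>i<length t. leq (\<not> s) (b ! i) (t ! i))"
  by (induction s t b rule: dominates.induct) (auto simp: All_less_Suc2)

lemma dominates_Nil_right [simp]: "dominates s t [] \<longleftrightarrow> t = []"
  by (cases t) auto

text \<open>Shifting the lower row one place to the right only puts letters below \<open>t\<close>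
  that come no later in the order.\<close>

lemma dominates_Cons_right: "dominates s t b \<Longrightarrow> row s (y # b) \<Longrightarrow> dominates s t (y # b)"
proof (induction s t b arbitrary: y rule: dominates.induct)
  case (3 s x t z b)
  then show ?case by (auto intro: leq_trans_mixed)
qed auto

inductive plactic :: "bool \<Rightarrow> 'a::linorder list \<Rightarrow> 'a list \<Rightarrow> bool" for s where
  refl [intro, simp]: "plactic s u u"
| sym: "plactic s u v \<Longrightarrow> plactic s v u"
| trans [trans]: "plactic s u v \<Longrightarrow> plactic s v w \<Longrightarrow> plactic s u w"
| append: "plactic s u u' \<Longrightarrow> plactic s v v' \<Longrightarrow> plactic s (u @ v) (u' @ v')"
| knuth1: "leq s x y \<Longrightarrow> leq (\<not> s) y z \<Longrightarrow> plactic s [x, z, y] [z, x, y]"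
| knuth2: "leq (\<not> s) x y \<Longrightarrow> leq s y z \<Longrightarrow> plactic s [y, x, z] [y, z, x]"

lemma plactic_rev: "plactic s u v \<Longrightarrow> plactic (\<not> s) (rev u) (rev v)"
proof (induction rule: plactic.induct)
  case (knuth1 x y z)
  then show ?case using plactic.knuth2[of "\<not> s" x y z] by (auto intro: plactic.sym)
next
  case (knuth2 x y z)
  then show ?case using plactic.knuth1[of "\<not> s" x y z] by (auto intro: plactic.sym)
qed (auto intro: plactic.intros)

lemma plactic_rev_iff: "plactic (\<not> s) (rev u) (rev v) \<longleftrightarrow> plactic s u v"
  using plactic_rev[of s u v] plactic_rev[of "\<not> s" "rev u" "rev v"] by auto

lemma plactic_set: "plactic s u v \<Longrightarrow> set u = set v"
  by (induction rule: plactic.induct) auto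

lemma plactic_prefix: "plactic s v v' \<Longrightarrow> plactic s (u @ v) (u @ v')"
  by (simp add: plactic.append)

lemma plactic_suffix: "plactic s u u' \<Longrightarrow> plactic s (u @ v) (u' @ v)"
  by (simp add: plactic.append)

text \<open>
  For rows \<open>a\<close> and \<open>b\<close>, this is the row insertion of \<open>b\<close> into \<open>a\<close>: the bumped letters, and
  what has become of \<open>a\<close>.
\<close>

fun row_merge :: "bool \<Rightarrow> 'a::linorder list \<Rightarrow> 'a list \<Rightarrow> 'a list \<times> 'a list" where
  "row_merge s [] b = ([], b)"
| "row_merge s (y # a) [] = ([], y # a)"
| "row_merge s (y # a) (x # b) =
    (if leq (\<not> s) x y then (let (t, m) = row_merge s a b in (y # t, x # m))
     else (let (t, m) = row_merge s a (x # b) in (t, y # m)))"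

section \<open>Insertion of a row into a row\<close>

lemma row_merge_Nil [simp]: "row_merge s a [] = ([], a)"
  by (cases a) auto

lemma row_merge_set:
  "row_merge s a b = (t, m) \<Longrightarrow> set t \<subseteq> set a \<and> set m \<subseteq> set a \<union> set b"
proof (induction s a b arbitrary: t m rule: row_merge.induct)
  case (3 s y a x b)
  show ?case
  proof (cases "leq (\<not> s) x y")
    case True
    obtain t' m' where m: "row_merge s a b = (t', m')" by fastforce
    show ?thesis using 3(1)[OF True m] 3(3) True m by auto
  next
    case False
    obtain t' m' where m: "row_merge s a (x # b) = (t', m')" by fastforce
    show ?thesis using 3(2)[OF False m] 3(3) False m by auto
  qed
qed auto

text \<open>A bump puts \<open>y\<close> and the letter \<open>x\<close> before it at the same place
  of the two results. A letter that is kept shifts the lower row to the right, which is harmless by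
  \<open>dominates_Cons_right\<close>.\<close>

lemma row_merge_rows:
  "row s a \<Longrightarrow> row s b \<Longrightarrow> row_merge s a b = (t, m) \<Longrightarrow> row s t \<and> row s m \<and> dominates s t m"
proof (induction s a b arbitrary: t m rule: row_merge.induct)
  case (3 s y a x b)
  show ?case
  proof (cases "leq (\<not> s) x y")
    case True
    obtain t' m' where m: "row_merge s a b = (t', m')" by fastforce
    have eq: "t = y # t'" "m = x # m'" using 3(5) True m by auto
    have "row s t'" "row s m'" "dominates s t' m'" using 3(1)[OF True _ _ m] 3(3,4) by auto
    moreover have "leq s y z" if "z \<in> set t'" for z
      using that row_merge_set[OF m] 3(3) by auto
    moreover have "leq s x z" if "z \<in> set m'" for z
    proof -
      have "z \<in> set a \<or> z \<in> set b" using that row_merge_set[OF m] by auto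
      then show ?thesis using 3(3,4) True leq_trans_mixed(2)[of s x y z s] by auto
    qed
    ultimately show ?thesis using True eq by simp
  next
    case False
    then have yx: "leq s y x" by (simp add: not_leq)
    obtain t' m' where m: "row_merge s a (x # b) = (t', m')" by fastforce
    have r: "row s t'" "row s m'" "dominates s t' m'" using 3(2)[OF False _ _ m] 3(3,4) by auto
    have eq: "t = t'" "m = y # m'" using 3(5) False m by auto
    have "row s (y # m')"
    proof -
      have "leq s y z" if "z \<in> set m'" for z
      proof -
        have "z \<in> set a \<or> z = x \<or> z \<in> set b" using that row_merge_set[OF m] by auto
        then show ?thesis using 3(3,4) yx leq_trans[of s y x z] by auto
      qed
      then show ?thesis using r by simp
    qed
    with r eq show ?thesis by (simp add: dominates_Cons_right del: sorted_wrt.simps)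
  qed
qed auto

text \<open>Each letter of \<open>b\<close> bumps the letter of \<open>t\<close> straight above it,
  so a pair in normal form is reproduced.\<close>

lemma row_merge_dominates: "dominates s t b \<Longrightarrow> row_merge s t b = (t, b)"
  by (induction s t b rule: dominates.induct) auto

lemma row_merge_single_cases:
  "row_merge s r [x] = (c, r') \<Longrightarrow>
    x \<in> set r' \<and> (c = [] \<and> r' = r @ [x] \<or> (\<exists>q. c = [q] \<and> q \<in> set r \<and> leq (\<not> s) x q))"
proof (induction r arbitrary: c r')
  case (Cons y r)
  obtain d m where m: "row_merge s r [x] = (d, m)" by fastforce
  show ?case using Cons.IH[OF m] Cons.prems m by (cases "leq (\<not> s) x y") auto
qed simp

text \<open>The letter \<open>x\<close> moves left past one letter of \<open>r\<close> at a time by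
  \<open>knuth2\<close>; the left neighbour of the letter being passed serves as the middle letter
  of the relation.\<close>

lemma plactic_slide: "row s (y # r) \<Longrightarrow> leq (\<not> s) x y \<Longrightarrow> plactic s (y # r @ [x]) (y # x # r)"
proof (induction r arbitrary: y)
  case (Cons z r)
  then have "leq (\<not> s) x z" by (auto intro: leq_trans_mixed)
  with Cons have "plactic s (z # r @ [x]) (z # x # r)" by simp
  from plactic_prefix[OF this, of "[y]"] have "plactic s (y # z # r @ [x]) ([y, z, x] @ r)" by simp
  also have "plactic s ([y, z, x] @ r) ([y, x, z] @ r)"
    using Cons.prems by (intro plactic_suffix plactic.sym[OF plactic.knuth2]) auto
  finally show ?case by simp
qed simp

lemma plactic_row_merge_single:
  "row s r \<Longrightarrow> row_merge s r [x] = (c, r') \<Longrightarrow> plactic s (c @ r') (r @ [x])"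
proof (induction r arbitrary: c r')
  case (Cons y r)
  show ?case
  proof (cases "leq (\<not> s) x y")
    case True
    then show ?thesis using Cons.prems plactic_slide[of s y r x] by (auto intro: plactic.sym)
  next
    case False
    then have yx: "leq s y x" by (simp add: not_leq)
    obtain d m where m: "row_merge s r [x] = (d, m)" by fastforce
    have r: "row s r" using Cons.prems by simp
    have eq: "c = d" "r' = y # m" using Cons.prems m False by auto
    from plactic_prefix[OF Cons.IH[OF r m], of "[y]"]
    have IH: "plactic s ([y] @ d @ m) (y # r @ [x])" by simp
    \<comment> \<open>The bumped letter \<open>q\<close> has to pass \<open>y\<close>. The head
      \<open>h\<close> of the new row lies between them, from \<open>y\<close> weakly and from
      \<open>q\<close> strictly if \<open>s\<close> holds, and so permits
      \<open>knuth1\<close>.\<close>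
    have "plactic s (d @ y # m) ([y] @ d @ m)"
      using row_merge_single_cases[OF m]
    proof (elim conjE disjE exE)
      fix q assume "x \<in> set m" and d: "d = [q]"
      then obtain h m' where m': "m = h # m'" by (cases m) auto
      have "leq s y h"
        using row_merge_set[OF m] m' Cons.prems(1) yx by auto
      moreover have "leq (\<not> s) h q" using row_merge_rows[OF r _ m] d m' by simp
      ultimately have "plactic s ([q, y, h] @ m') ([y, q, h] @ m')"
        by (intro plactic_suffix plactic.sym[OF plactic.knuth1])
      then show ?thesis using d m' by simp
    qed simp
    also note IH
    finally show ?thesis using eq by simp
  qed
qed simp

lemma row_merge_Cons_le:
  "\<forall>z\<in>set b. leq s y z \<Longrightarrow> row_merge s (y # a) b = (let (t, m) = row_merge s a b in (t, y # m))"
  by (cases b) (auto simp: leq_D)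

text \<open>A single pass from left to right agrees with insertion letter by letter because
  \<open>x # b\<close> is a row: once \<open>x\<close> is placed, the later letters go to its
  right.\<close>

lemma row_merge_Cons_right:
  "row s (x # b) \<Longrightarrow> row_merge s r (x # b) =
    (let (c, r1) = row_merge s r [x]; (d, r2) = row_merge s r1 b in (c @ d, r2))"
proof (induction r)
  case Nil
  then show ?case by (simp add: row_merge_Cons_le)
next
  case (Cons y r)
  show ?case
  proof (cases "leq (\<not> s) x y")
    case True
    with Cons.prems show ?thesis by (simp add: row_merge_Cons_le split: prod.splits)
  next
    case False
    then have "leq s y x" by (simp add: not_leq)
    then have "\<forall>z\<in>set b. leq s y z" using Cons.prems by (auto intro: leq_trans)
    with Cons False show ?thesis by (simp add: row_merge_Cons_le split: prod.splits)
  qed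
qed

section \<open>Insertion of words into a single row, and its invariance under the Knuth
  relations\<close>

primrec insert_word :: "bool \<Rightarrow> 'a::linorder list \<Rightarrow> 'a list \<Rightarrow> 'a list \<times> 'a list" where
  "insert_word s r [] = ([], r)"
| "insert_word s r (x # w) =
    (let (c, r1) = row_merge s r [x]; (d, r2) = insert_word s r1 w in (c @ d, r2))"

lemma insert_word_Cons_le:
  "\<forall>z\<in>set w. leq s y z \<Longrightarrow>
    insert_word s (y # r) w = (let (c, r') = insert_word s r w in (c, y # r'))"
  by (induction w arbitrary: r) (auto simp: leq_D split: prod.splits)

lemma insert_word_append:
  "insert_word s r (u @ v) =
    (let (c, r1) = insert_word s r u; (d, r2) = insert_word s r1 v in (c @ d, r2))"
  by (induction u arbitrary: r) (auto split: prod.splits)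

lemma insert_word_row: "row s b \<Longrightarrow> insert_word s r b = row_merge s r b"
proof (induction b arbitrary: r)
  case (Cons x b)
  then have "insert_word s r' b = row_merge s r' b" for r' by simp
  then show ?case by (simp add: row_merge_Cons_right[OF Cons.prems])
qed simp

lemma insert_word_properties:
  "row s r \<Longrightarrow> insert_word s r w = (c, r') \<Longrightarrow> row s r' \<and> plactic s (c @ r') (r @ w)"
proof (induction w arbitrary: r c)
  case (Cons x w)
  obtain d r1 where m: "row_merge s r [x] = (d, r1)" by fastforce
  obtain e r2 where w: "insert_word s r1 w = (e, r2)" by fastforce
  have r1: "row s r1" using row_merge_rows[OF Cons.prems(1) _ m] by simp
  have eq: "c = d @ e" "r' = r2" using Cons.prems m w by auto
  have IH: "row s r2 \<and> plactic s (e @ r2) (r1 @ w)" using Cons.IH[OF r1] w eq by simp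
  from plactic_prefix[OF conjunct2[OF this], of d]
  have "plactic s (c @ r') ((d @ r1) @ w)" using eq by simp
  also have "plactic s \<dots> ((r @ [x]) @ w)"
    by (rule plactic_suffix) (rule plactic_row_merge_single[OF Cons.prems(1) m])
  finally show ?case using IH eq by simp
qed simp

lemma plactic_row_merge:
  "row s a \<Longrightarrow> row s b \<Longrightarrow> row_merge s a b = (t, m) \<Longrightarrow> plactic s (t @ m) (a @ b)"
  using insert_word_properties[of s a b t m] by (simp add: insert_word_row)

text \<open>Insertion bumps the leftmost letter beyond \<open>y\<close>, which cannot be to the
  right of \<open>z\<close>.\<close>

lemma row_merge_single_le:
  "row s r \<Longrightarrow> z \<in> set r \<Longrightarrow> leq (\<not> s) y z \<Longrightarrow> row_merge s r [y] = (c, r') \<Longrightarrow>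
    \<exists>b. c = [b] \<and> b \<in> set r \<and> leq (\<not> s) y b \<and> (b = z \<or> leq s b z)"
proof (induction r arbitrary: c r')
  case (Cons p r)
  show ?case
  proof (cases "leq (\<not> s) y p")
    case False
    with Cons.prems have "p \<noteq> z" by auto
    obtain d m where m: "row_merge s r [y] = (d, m)" by fastforce
    show ?thesis using Cons.IH[OF _ _ Cons.prems(3) m] Cons.prems m False \<open>p \<noteq> z\<close> by auto
  qed (use Cons.prems in auto)
qed simp

text \<open>If the first letter \<open>p\<close> of the row is not beyond \<open>x\<close>, it stays
  where it is and the induction hypothesis applies to the rest. Otherwise \<open>p\<close> is
  bumped, and the two bumped words are equal or differ by one Knuth relation.\<close>

lemma insert_word_knuth1:
  assumes "row s r" "leq s x y" "leq (\<not> s) y z"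
  shows "snd (insert_word s r [x, z, y]) = snd (insert_word s r [z, x, y]) \<and>
    plactic s (fst (insert_word s r [x, z, y])) (fst (insert_word s r [z, x, y]))"
  using assms
proof (induction r)
  case Nil
  then show ?case by (auto simp: leq_def)
next
  case (Cons p r)
  have xz: "leq s' x z" for s' using Cons.prems by (auto intro: leq_trans_mixed)
  have nyx: "\<not> leq (\<not> s) y x" using Cons.prems by (simp add: not_leq)
  have nzx: "\<not> leq (\<not> s) z x" using xz by (simp add: not_leq)
  have r: "row s r" using Cons.prems by simp
  show ?case
  proof (cases "leq (\<not> s) x p")
    case False
    then have "leq s p x" by (simp add: not_leq)
    with Cons.prems xz have "leq s p y" "leq s p z" by (auto intro: leq_trans)
    with \<open>leq s p x\<close> show ?thesis
      using Cons.IH[OF r] Cons.prems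
      by (simp add: insert_word_Cons_le case_prod_beta Let_def del: insert_word.simps)
  next
    case xp: True
    obtain bz r1 where m1: "row_merge s r [z] = (bz, r1)" by fastforce
    obtain b' r2 where m2: "row_merge s r1 [y] = (b', r2)" by fastforce
    have r1: "row s r1" "z \<in> set r1" "set r1 \<subseteq> set r \<union> {z}"
      using row_merge_rows[OF r _ m1] row_merge_single_cases[OF m1] row_merge_set[OF m1] by auto
    show ?thesis
    proof (cases "leq (\<not> s) z p")
      case False
      then have pz: "leq s p z" by (simp add: not_leq)
      \<comment> \<open>The bumped words are \<open>p\<close>, \<open>bz\<close>, \<open>b'\<close>
        and \<open>bz\<close>, \<open>p\<close>, \<open>b'\<close>. The letter \<open>b\<close>
        bumped by \<open>y\<close> lies between \<open>p\<close> and \<open>z\<close>, hence between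
        \<open>p\<close> and any letter \<open>q\<close> that \<open>z\<close> has bumped, as
        \<open>knuth1\<close> requires.\<close>
      obtain b where b: "b' = [b]" "b \<in> set r1" "b = z \<or> leq s b z"
        using row_merge_single_le[OF r1(1,2) Cons.prems(3) m2] by auto
      have pb: "leq s p b" using b r1(3) pz Cons.prems(1) by auto
      have w: "insert_word s (p # r) [x, z, y] = ([p] @ bz @ b', x # r2)"
        "insert_word s (p # r) [z, x, y] = (bz @ [p] @ b', x # r2)"
        using xp False nyx nzx m1 m2 by auto
      from row_merge_single_cases[OF m1]
      have "plactic s ([p] @ bz @ b') (bz @ [p] @ b')"
      proof (elim conjE disjE exE)
        fix q assume q: "bz = [q]" "leq (\<not> s) z q"
        then have "leq (\<not> s) b q" using b(3) by (auto intro: leq_trans_mixed)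
        with pb q b show ?thesis by (auto intro: plactic.knuth1)
      qed simp
      with w show ?thesis by simp
    next
      case zp: True
      \<comment> \<open>Now \<open>z\<close> comes before \<open>p\<close> as well. If
        \<open>r\<close> is empty, both bumped words are \<open>p\<close>, \<open>z\<close>; if it
        begins with \<open>q\<close>, they are \<open>p\<close>, \<open>q\<close>, \<open>z\<close>
        and \<open>p\<close>, \<open>z\<close>, \<open>q\<close>.\<close>
      show ?thesis
      proof (cases r)
        case Nil
        with xp zp nyx nzx xz Cons.prems show ?thesis by simp
      next
        case (Cons q r')
        have pq: "leq s p q" using \<open>row s (p # r)\<close> Cons by simp
        then have zq: "leq (\<not> s) z q" "leq (\<not> s) y q"
          using zp Cons.prems by (auto intro: leq_trans_mixed leq_trans)
        have "plactic s [p, q, z] [p, z, q]"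
          using zp pq by (intro plactic.sym[OF plactic.knuth2])
        then show ?thesis using Cons xp zp zq nyx nzx xz \<open>leq (\<not> s) y z\<close> by simp
      qed
    qed
  qed
qed

lemma insert_word_knuth2:
  assumes "row s r" "leq (\<not> s) x y" "leq s y z"
  shows "snd (insert_word s r [y, x, z]) = snd (insert_word s r [y, z, x]) \<and>
    plactic s (fst (insert_word s r [y, x, z])) (fst (insert_word s r [y, z, x]))"
  using assms
proof (induction r)
  case Nil
  then show ?case by (auto simp: leq_def)
next
  case (Cons p r)
  have xz: "leq s' x z" for s' using Cons.prems by (auto intro: leq_trans_mixed)
  have nzx: "\<not> leq (\<not> s) z x" using xz by (simp add: not_leq)
  have nzy: "\<not> leq (\<not> s) z y" using Cons.prems by (simp add: not_leq)
  have r: "row s r" using Cons.prems by simp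
  show ?case
  proof (cases "leq (\<not> s) x p")
    case False
    then have "leq s p x" by (simp add: not_leq)
    with Cons.prems xz have "leq s p y" "leq s p z" by (auto intro: leq_trans leq_trans_mixed)
    with \<open>leq s p x\<close> show ?thesis
      using Cons.IH[OF r] Cons.prems
      by (simp add: insert_word_Cons_le case_prod_beta Let_def del: insert_word.simps)
  next
    case xp: True
    show ?thesis
    proof (cases "leq (\<not> s) y p")
      case yp: True
      obtain bz r1 where m: "row_merge s r [z] = (bz, r1)" by fastforce
      have w: "insert_word s (p # r) [y, x, z] = ([p, y] @ bz, x # r1)"
        "insert_word s (p # r) [y, z, x] = ([p] @ bz @ [y], x # r1)"
        using xp yp nzx nzy m Cons.prems by auto
      from row_merge_single_cases[OF m]
      have "plactic s ([p, y] @ bz) ([p] @ bz @ [y])"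
      proof (elim conjE disjE exE)
        fix q assume "bz = [q]" "q \<in> set r"
        with yp Cons.prems show ?thesis by (auto intro: plactic.knuth2)
      qed simp
      with w show ?thesis by simp
    next
      case False
      then have py: "leq s p y" by (simp add: not_leq)
      then have "leq s p z" using Cons.prems by (auto intro: leq_trans)
      then have nzp: "\<not> leq (\<not> s) z p" by (simp add: not_leq)
      obtain c r1 where m1: "row_merge s r [y] = (c, r1)" by fastforce
      obtain d r2 where m2: "row_merge s r1 [z] = (d, r2)" by fastforce
      have w: "insert_word s (p # r) [y, x, z] = (c @ [p] @ d, x # r2)"
        "insert_word s (p # r) [y, z, x] = (c @ d @ [p], x # r2)"
        using xp False nzx nzp m1 m2 by auto
      have yz: "row s [y, z]" using Cons.prems by simp
      have m: "row_merge s r [y, z] = (c @ d, r2)"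
        using row_merge_Cons_right[OF yz] m1 m2 by simp
      from row_merge_single_cases[OF m1] row_merge_single_cases[OF m2]
      have "plactic s (c @ [p] @ d) (c @ d @ [p])"
      proof (elim conjE disjE exE)
        fix b q assume q: "c = [b]" "leq (\<not> s) y b" "d = [q]"
        have "leq s b q" using row_merge_rows[OF r yz m] q by simp
        moreover have "leq (\<not> s) p b" using py q by (auto intro: leq_trans_mixed)
        ultimately show ?thesis using q by (auto intro: plactic.knuth2)
      next
        \<comment> \<open>An impossible case: if \<open>y\<close> was appended at the end of the
          row, no letter of the row is beyond \<open>z\<close>, so \<open>z\<close> bumps
          nothing.\<close>
        fix q assume "c = []" and r1: "r1 = r @ [y]" and q: "d = [q]" "q \<in> set r1" "leq (\<not> s) z q"
        have "row s r1" using row_merge_rows[OF r _ m1] by simp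
        then have "q = y \<or> leq s q y" using q r1 by (auto simp: sorted_wrt_append)
        then have "leq s q z" using Cons.prems by (auto intro: leq_trans)
        with q(3) have "leq s q q" "leq (\<not> s) q q" by (auto intro: leq_trans_mixed)
        then show ?thesis by (auto simp: leq_def)
      qed auto
      with w show ?thesis by simp
    qed
  qed
qed

lemma insert_word_plactic:
  "plactic s u v \<Longrightarrow> row s r \<Longrightarrow>
    snd (insert_word s r u) = snd (insert_word s r v) \<and>
    plactic s (fst (insert_word s r u)) (fst (insert_word s r v))"
proof (induction arbitrary: r rule: plactic.induct)
  case (append u u' v v')
  obtain c r1 where c: "insert_word s r u = (c, r1)" by fastforce
  obtain c' where c': "insert_word s r u' = (c', r1)" "plactic s c c'"
    using append.IH(1)[OF append.prems] c by (metis fst_conv snd_conv surj_pair)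
  have "row s r1" using insert_word_properties[OF append.prems c] by simp
  from append.IH(2)[OF this] c c' show ?case
    by (auto simp: insert_word_append intro: plactic.append split: prod.splits)
next
  case (trans u v w)
  then show ?case by (metis plactic.trans)
qed (auto intro: plactic.sym simp del: insert_word.simps dest: insert_word_knuth1 insert_word_knuth2)

text \<open>Each row bumps exactly the row above it, so insertion hands back the bottom row and the
  reading of everything above.\<close>

lemma insert_word_chain:
  "\<lbrakk>\<forall>r\<in>set (ts @ [b]). row s r; successively (dominates s) (ts @ [b])\<rbrakk> \<Longrightarrow>
    insert_word s [] (concat (ts @ [b])) = (concat ts, b)"
proof (induction ts arbitrary: b rule: rev_induct)
  case Nil
  then show ?case by (simp add: insert_word_row)
next
  case (snoc t ts)
  then have "dominates s t b" "row s b" "insert_word s [] (concat (ts @ [t])) = (concat ts, t)"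
    by (auto simp: successively_append_iff)
  then show ?case
    using insert_word_append[of s "[]" "concat (ts @ [t])" b]
    by (simp add: insert_word_row row_merge_dominates)
qed

lemma row_chain_unique:
  "\<lbrakk>\<forall>r\<in>set xs. row s r; successively (dominates s) xs; \<forall>r\<in>set ys. row s r;
    successively (dominates s) ys; length xs = length ys; plactic s (concat xs) (concat ys)\<rbrakk>
   \<Longrightarrow> xs = ys"
proof (induction xs arbitrary: ys rule: rev_induct)
  case (snoc x xs)
  then obtain y zs where ys: "ys = zs @ [y]" by (cases ys rule: rev_cases) auto
  have "insert_word s [] (concat (xs @ [x])) = (concat xs, x)"
    using snoc.prems by (intro insert_word_chain)
  moreover have "insert_word s [] (concat (zs @ [y])) = (concat zs, y)"
    using snoc.prems unfolding ys by (intro insert_word_chain)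
  ultimately have "x = y" "plactic s (concat xs) (concat zs)"
    using insert_word_plactic[OF snoc.prems(6), of "[]"] by (simp_all add: ys)
  then show ?case using snoc ys by (simp add: successively_append_iff)
qed simp

text \<open>Replaces the abstractly given normal forms in \<open>dom_right\<close> and
  \<open>dom_left\<close> by computed ones.\<close>

lemma row_merge_unique:
  assumes "row s a" "row s b" "row s t" "row s c" "dominates s t c" "plactic s (t @ c) (a @ b)"
  shows "row_merge s a b = (t, c)"
proof -
  obtain t' c' where m: "row_merge s a b = (t', c')" by fastforce
  note p = row_merge_rows[OF assms(1,2) m] plactic_row_merge[OF assms(1,2) m]
  have "plactic s (concat [t', c']) (concat [t, c])"
    using p assms(6) by (auto intro: plactic.sym plactic.trans)
  then have "[t', c'] = [t, c]" using p assms by (intro row_chain_unique[of _ s]) auto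
  then show ?thesis using m by simp
qed

section \<open>Letterwise comparison of three rows\<close>

lemma row_merge_bumped:
  "row_merge s a b = (t, m) \<Longrightarrow> z \<in> set t \<Longrightarrow> \<exists>x\<in>set b. leq (\<not> s) x z"
proof (induction s a b arbitrary: t m rule: row_merge.induct)
  case (3 s y a x b)
  show ?case
  proof (cases "leq (\<not> s) x y")
    case True
    obtain t' m' where m: "row_merge s a b = (t', m')" by fastforce
    show ?thesis using 3(1)[OF True m] 3(3,4) True m by auto
  next
    case False
    obtain t' m' where m: "row_merge s a (x # b) = (t', m')" by fastforce
    show ?thesis using 3(2)[OF False m] 3(3,4) False m by auto
  qed
qed auto

text \<open>The induction step shared by both cases of \<open>row_merge_dominates_right\<close>. The
  row below \<open>t\<close> starts with \<open>y\<close>; \<open>h\<close> is the first letter of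
  its outcome, namely \<open>y\<close> or the letter that bumped it, and \<open>g\<close> is what
  the rest \<open>b\<close> releases. The last premise says that \<open>f\<close> begins with the
  bumped \<open>y\<close> or consists of letters released further right.\<close>

lemma dominates_row_merge_step:
  assumes IH: "\<And>t f. dominates s t b \<Longrightarrow> subseq f g \<Longrightarrow> dominates s (snd (row_merge s t f)) c"
    and "dominates s t (y # b)" and h: "h = y \<or> leq (\<not> s) h y"
    and f: "\<And>z f'. f = z # f' \<Longrightarrow> leq (\<not> s) h z \<and> subseq f' g \<and> (z = y \<or> subseq f g)"
  shows "dominates s (snd (row_merge s t f)) (h # c)"
proof (cases t)
  case Nil
  show ?thesis
  proof (cases f)
    case f': (Cons z f')
    then show ?thesis using IH[of "[]" f'] f[OF f'] Nil by simp
  qed (use Nil in simp)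
next
  case (Cons t1 t0)
  then have t: "leq (\<not> s) y t1" "dominates s t0 b" using assms(2) by auto
  then have ht: "leq (\<not> s) h t1" using h by (auto intro: leq_trans)
  show ?thesis
  proof (cases f)
    case Nil
    then show ?thesis using Cons ht IH[OF t(2), of "[]"] by simp
  next
    case f': (Cons z f')
    show ?thesis
    proof (cases "leq (\<not> s) z t1")
      case True
      then show ?thesis
        using Cons f' f[OF f'] IH[OF t(2), of f']
        by (cases "row_merge s t0 f'") simp
    next
      case False
      then have "subseq f g" using f[OF f'] t(1) by auto
      then show ?thesis
        using False Cons f' ht IH[OF t(2), of f] by (cases "row_merge s t0 f") simp
    qed
  qed
qed

text \<open>
  Generalising from \<open>b'\<close> to its subsequences makes the induction go through: \<open>t\<close> may use up a
  letter of \<open>b'\<close> before the row \<open>b\<close> has released it.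
\<close>

lemma row_merge_dominates_right:
  "\<lbrakk>row_merge s b r = (b', b''); row s b; row s r; dominates s t b; subseq f b'\<rbrakk> \<Longrightarrow>
    dominates s (snd (row_merge s t f)) b''"
proof (induction s b r arbitrary: t f b' b'' rule: row_merge.induct)
  case (3 s y b x r)
  show ?case
  proof (cases "leq (\<not> s) x y")
    case True
    obtain g c where m: "row_merge s b r = (g, c)" by fastforce
    have eq: "b' = y # g" "b'' = x # c" using 3(3) True m by auto
    have IH: "dominates s (snd (row_merge s t f)) c" if "dominates s t b" "subseq f g" for t f
      using 3(1)[OF True m] 3(4,5) that by simp
    show ?thesis unfolding eq
    proof (rule dominates_row_merge_step[OF IH 3(6)])
      fix z f' assume f: "f = z # f'"
      have "subseq f' g" using 3(7) f eq by (metis subseq_Cons' subseq_Cons2_iff)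
      moreover have "z = y \<or> subseq f g" using 3(7) f eq by (metis subseq_Cons2_neq)
      moreover have "leq (\<not> s) x z" if "subseq f g"
      proof -
        have "z \<in> set b" using that f row_merge_set[OF m] by (auto dest: list_emb_set)
        then show ?thesis using True 3(4) leq_trans_mixed(2)[of s x y z] by auto
      qed
      ultimately show "leq (\<not> s) x z \<and> subseq f' g \<and> (z = y \<or> subseq f g)" using True by auto
    qed (use True in auto)
  next
    case False
    then have yx: "leq s y x" by (simp add: not_leq)
    obtain g c where m: "row_merge s b (x # r) = (g, c)" by fastforce
    have eq: "b' = g" "b'' = y # c" using 3(3) False m by auto
    have IH: "dominates s (snd (row_merge s t f)) c" if "dominates s t b" "subseq f g" for t f
      using 3(2)[OF False m] 3(4,5) that by simp
    show ?thesis unfolding eq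
    proof (rule dominates_row_merge_step[OF IH 3(6)])
      fix z f' assume f: "f = z # f'"
      then have "z \<in> set g" using 3(7) eq by (auto dest: list_emb_set)
      then obtain w where w: "w = x \<or> w \<in> set r" "leq (\<not> s) w z"
        using row_merge_bumped[OF m] by auto
      then have "leq s y w" using yx 3(5) leq_trans[of s y x w] by auto
      then have "leq (\<not> s) y z" using w(2) by (rule leq_trans_mixed)
      then show "leq (\<not> s) y z \<and> subseq f' g \<and> (z = y \<or> subseq f g)"
        using 3(7) f eq by (auto dest: subseq_Cons')
    qed auto
  qed
qed (auto dest: list_emb_Nil2)

lemma row_merge_subseq:
  "row_merge s a b = (t, m) \<Longrightarrow> subseq b m \<and> dominates s t b"
proof (induction s a b arbitrary: t m rule: row_merge.induct)
  case (3 s y a x b)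
  show ?case
  proof (cases "leq (\<not> s) x y")
    case True
    obtain t' m' where m: "row_merge s a b = (t', m')" by fastforce
    show ?thesis using 3(1)[OF True m] 3(3) True m by auto
  next
    case False
    obtain t' m' where m: "row_merge s a (x # b) = (t', m')" by fastforce
    show ?thesis using 3(2)[OF False m] 3(3) False m by auto
  qed
qed auto

text \<open>The subsequence \<open>t\<close> shows letters of \<open>m\<close> that \<open>b\<close>
  could bump one by one. Insertion is greedy: it bumps at least as many, and each no later than the
  corresponding letter of \<open>t\<close>. Hence what dominates \<open>t\<close> dominates
  \<open>m'\<close>; stating this through \<open>u\<close> expresses the weak comparison of
  \<open>m'\<close> with \<open>t\<close> by domination alone.\<close>

lemma row_merge_dominates_left:
  "\<lbrakk>row_merge s m b = (m', b'); row s m; subseq t m; dominates s t b; dominates s u t\<rbrakk> \<Longrightarrow>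
    dominates s u m'"
proof (induction s m b arbitrary: m' b' t u rule: row_merge.induct)
  case (3 s y m x b)
  show ?case
  proof (cases t)
    case Nil
    then show ?thesis using 3(7) by simp
  next
    case (Cons t1 t0)
    then have t: "leq (\<not> s) x t1" "dominates s t0 b" using 3(6) by auto
    show ?thesis
    proof (cases "leq (\<not> s) x y")
      case True
      obtain g c where m: "row_merge s m b = (g, c)" by fastforce
      have eq: "m' = y # g" using 3(3) True m by auto
      have sub: "subseq t0 m" using 3(5) Cons by (metis subseq_Cons' subseq_Cons2_iff)
      have "t1 \<in> set (y # m)" using list_emb_set[OF 3(5), of t1] Cons by auto
      then have t1: "t1 = y \<or> leq s y t1" using 3(4) by auto
      show ?thesis
      proof (cases u)
        case u: (Cons u1 u0)
        then have "leq (\<not> s) t1 u1" "dominates s u0 t0" using 3(7) Cons by auto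
        moreover have "leq (\<not> s) y u1"
          using t1 calculation(1) by (auto intro: leq_trans_mixed)
        moreover have "dominates s u0 g" using 3(1)[OF True m _ sub t(2)] 3(4) calculation by simp
        ultimately show ?thesis using u eq by simp
      qed simp
    next
      case False
      obtain g c where m: "row_merge s m (x # b) = (g, c)" by fastforce
      have eq: "m' = g" using 3(3) False m by auto
      have "t1 \<noteq> y" using t False by auto
      then have "subseq t m" using 3(5) Cons by (simp add: subseq_Cons2_neq)
      from 3(2)[OF False m _ this 3(6,7)] show ?thesis using eq 3(4) by simp
    qed
  qed
qed (auto dest: list_emb_Nil2)

lemma normal_forms_rows:
  "normal_forms (row s) (dominates s) (\<lambda>xs ys. plactic s (concat xs) (concat ys))"
proof (rule normal_forms.intro, goal_cases)
  case (5 a b)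
  obtain t c where m: "row_merge s a b = (t, c)" by fastforce
  show ?case using row_merge_rows[OF 5 m] plactic_row_merge[OF 5 m] by auto
next
  case (6 xs ys)
  then show ?case using row_chain_unique[of xs s ys] by (simp add: list_all_iff)
next
  case (7 t b r b' b'' t' m)
  have "row_merge s b r = (b', b'')" "row_merge s t b' = (t', m)"
    using 7 by (auto intro: row_merge_unique)
  then show ?case using row_merge_dominates_right[of s b r b' b'' t b'] 7 by simp
next
  case (8 t b r t' m m' b')
  have m: "row_merge s r t = (t', m)" "row_merge s m b = (m', b')"
    using 8 by (auto intro: row_merge_unique)
  show ?case using row_merge_dominates_left[OF m(2)] row_merge_subseq[OF m(1)] 8 by blast
qed (auto intro: plactic.intros)

section \<open>Tableaux\<close>

definition tableau :: "bool \<Rightarrow> 'a::linorder list list \<Rightarrow> bool" where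
  "tableau s T \<longleftrightarrow> (\<forall>r\<in>set T. row s r \<and> r \<noteq> []) \<and> successively (dominates s) T"

lemma tableau_Nil [simp]: "tableau s []"
  by (simp add: tableau_def)

lemma leq_simps: "leq True = (\<le>)" "leq False = (<)"
  by (auto simp: leq_def fun_eq_iff)

lemma transp_leq: "transp (leq s)" "transp (\<lambda>x y. leq s y x)"
  by (auto intro: transpI leq_trans)

lemma row_dom_eq: "(\<succ>\<^sub>R) = dominates True"
  by (simp add: fun_eq_iff row_dom_def dominates_iff_nth leq_simps)

lemma YT_iff: "T \<in> YT A \<longleftrightarrow> tableau True T \<and> set (concat T) \<subseteq> A"
  by (auto simp: YT_def tableau_def is_row_def row_dom_eq leq_simps)

lemma tableau_pad:
  "tableau s T \<Longrightarrow>
    (\<forall>r\<in>set (replicate k [] @ T). row s r) \<and> successively (dominates s) (replicate k [] @ T)"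
  by (induction k) (auto simp: tableau_def successively_Cons)

text \<open>Only an empty row can stand above an empty row.\<close>

lemma row_chain_cases:
  assumes "\<forall>r\<in>set xs. row s r" "successively (dominates s) xs"
  obtains k T where "xs = replicate k [] @ T" "tableau s T"
proof -
  have "\<exists>k T. xs = replicate k [] @ T \<and> tableau s T"
    using assms
  proof (induction xs)
    case (Cons x xs)
    then obtain k T where T: "xs = replicate k [] @ T" "tableau s T"
      by (auto simp: successively_Cons)
    show ?case
    proof (cases "x = []")
      case True
      then have "x # xs = replicate (Suc k) [] @ T" using T by simp
      then show ?thesis using T(2) by blast
    next
      case False
      then have "k = 0" using T Cons.prems(2) by (cases k) auto
      then have "x # xs = replicate 0 [] @ x # T" "tableau s (x # T)"
        using T Cons.prems False by (auto simp: tableau_def)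
      then show ?thesis by blast
    qed
  qed simp
  then show thesis using that by blast
qed

lemma replicate_append_eq_iff:
  assumes "\<forall>r\<in>set T. r \<noteq> z" "\<forall>r\<in>set T'. r \<noteq> z"
  shows "replicate k z @ T = replicate k' z @ T' \<longleftrightarrow> k = k' \<and> T = T'"
proof
  assume eq: "replicate k z @ T = replicate k' z @ T'"
  from arg_cong[OF this, of "filter (\<lambda>r. r \<noteq> z)"] have "T = T'"
    using assms by simp
  with eq show "k = k' \<and> T = T'" by (auto dest: arg_cong[where f = length])
qed simp

lemma tableau_unique:
  assumes "tableau s T" "tableau s T'" "plactic s (concat T) (concat T')"
  shows "T = T'"
proof -
  \<comment> \<open>Padding each tableau by the length of the other makes the lengths equal.\<close>
  let ?xs = "replicate (length T') [] @ T" and ?ys = "replicate (length T) [] @ T'"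
  have "?xs = ?ys"
    using tableau_pad[OF assms(1)] tableau_pad[OF assms(2)] assms(3)
    by (intro row_chain_unique[of _ s]) auto
  then show ?thesis
    using assms(1,2) replicate_append_eq_iff[of T "[]" T'] by (auto simp: tableau_def)
qed

section \<open>Schensted insertion computes the tableau of a plactic class\<close>

lemma row_merge_single:
  "sorted r \<Longrightarrow> row_merge True r [x] =
    (if r = [] \<or> last r \<le> x then ([], r @ [x])
     else let i = (LEAST i. i < length r \<and> x < r ! i) in ([r ! i], r[i := x]))"
proof (induction r)
  case (Cons y r)
  show ?case
  proof (cases "x < y")
    case True
    have "y \<le> z" if "z \<in> set (y # r)" for z using that Cons.prems by auto
    from this[OF last_in_set] have "\<not> last (y # r) \<le> x" using True by (simp add: not_le)
    moreover have "(LEAST i. i < length (y # r) \<and> x < (y # r) ! i) = 0"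
      using True by (intro Least_equality) auto
    ultimately show ?thesis using True by (simp add: leq_simps)
  next
    case False
    show ?thesis
    proof (cases "r = [] \<or> last r \<le> x")
      case True
      then show ?thesis using Cons False by (auto simp: leq_simps)
    next
      case bump: False
      \<comment> \<open>The last letter of \<open>r\<close> is beyond \<open>x\<close>: the witness
        that \<open>Least_Suc\<close> asks for.\<close>
      then have "length r - 1 < length r \<and> x < r ! (length r - 1)"
        by (auto simp: last_conv_nth)
      then have ex: "Suc (length r - 1) < length (y # r) \<and> x < (y # r) ! Suc (length r - 1)"
        by simp
      have "(LEAST i. i < length (y # r) \<and> x < (y # r) ! i)
          = Suc (LEAST i. Suc i < length (y # r) \<and> x < (y # r) ! Suc i)"
        using False by (intro Least_Suc[where P = "\<lambda>i. i < length (y # r) \<and> x < (y # r) ! i", OF ex]) simp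
      then show ?thesis using Cons False bump by (simp add: Let_def leq_simps)
    qed
  qed
qed simp

lemma schensted_insert_Nil: "schensted_insert [] x = [[x]]"
  by (simp add: schensted_insert.simps)

lemma schensted_insert_snoc:
  assumes "sorted r" "r \<noteq> []" "row_merge True r [x] = (c, r')"
  shows "schensted_insert (U @ [r]) x = (if c = [] then U else schensted_insert U (hd c)) @ [r']"
  using assms row_merge_single[OF assms(1), of x]
  by (subst schensted_insert.simps) (auto simp: Let_def split: if_splits)

lemma tableau_snoc:
  "tableau s (U @ [r]) \<longleftrightarrow>
    tableau s U \<and> row s r \<and> r \<noteq> [] \<and> (U \<noteq> [] \<longrightarrow> dominates s (last U) r)"
  by (auto simp: tableau_def successively_append_iff)

text \<open>The new last row of \<open>U\<close> has to dominate \<open>r'\<close>. This is the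
  three-row comparison for the last row of \<open>U\<close>, the row \<open>r\<close> and the letter
  \<open>x\<close>, and it is available only if the induction also keeps track of the last
  row.\<close>

lemma schensted_insert_tableau:
  "tableau True T \<Longrightarrow>
    tableau True (schensted_insert T x) \<and> schensted_insert T x \<noteq> [] \<and>
    last (schensted_insert T x) = snd (row_merge True (if T = [] then [] else last T) [x]) \<and>
    plactic True (concat (schensted_insert T x)) (concat T @ [x])"
proof (induction T arbitrary: x rule: rev_induct)
  case Nil
  then show ?case by (simp add: schensted_insert_Nil tableau_def)
next
  case (snoc r U)
  then have U: "tableau True U" and r: "row True r" "r \<noteq> []"
    and dom: "U \<noteq> [] \<Longrightarrow> dominates True (last U) r"
    by (auto simp: tableau_snoc)
  obtain c r' where m: "row_merge True r [x] = (c, r')" by fastforce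
  note ins = schensted_insert_snoc[of r x c r' U, OF _ r(2) m]
  have r': "row True r'" "dominates True c r'" "r' \<noteq> []"
    using row_merge_rows[OF r(1) _ m] row_merge_single_cases[OF m] by auto
  have p: "plactic True (c @ r') (r @ [x])" using plactic_row_merge[OF r(1) _ m] by simp
  \<comment> \<open>If there is no row above, the empty row stands in for it: it dominates
    \<open>r\<close>, and inserting \<open>c\<close> into it gives \<open>c\<close>.\<close>
  define t where "t = (if U = [] then [] else last U)"
  have "dominates True t r" using dom by (simp add: t_def)
  then have below: "dominates True (snd (row_merge True t c)) r'"
    using row_merge_dominates_right[OF m r(1) _ _, of t c] by simp
  consider "c = []" | q where "c = [q]" using row_merge_single_cases[OF m] by auto
  then show ?case
  proof cases
    case 1
    then have "schensted_insert (U @ [r]) x = U @ [r']" using ins r by (simp add: leq_simps)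
    moreover have "tableau True (U @ [r'])"
      using U r' below 1 by (auto simp: tableau_snoc t_def split: if_splits)
    ultimately show ?thesis using m p 1 plactic_prefix[of True r' "r @ [x]" "concat U"] by simp
  next
    case (2 q)
    then have eq: "schensted_insert (U @ [r]) x = schensted_insert U q @ [r']"
      using ins r by (simp add: leq_simps)
    note IH = snoc.IH[OF U, of q]
    then have "plactic True (concat (schensted_insert U q) @ r') ((concat U @ [q]) @ r')"
      by (intro plactic_suffix) auto
    also have "plactic True ((concat U @ [q]) @ r') (concat U @ r @ [x])"
      using plactic_prefix[OF p, of "concat U"] 2 by simp
    finally show ?thesis
      using eq IH r' below m 2 by (auto simp: tableau_snoc t_def)
  qed
qed

lemma foldl_schensted_insert:
  "tableau True T \<Longrightarrow> tableau True (foldl schensted_insert T w) \<and>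
    plactic True (concat (foldl schensted_insert T w)) (concat T @ w)"
proof (induction w arbitrary: T)
  case (Cons x w)
  note i = schensted_insert_tableau[OF Cons.prems, of x]
  with Cons.IH[of "schensted_insert T x"]
  have "plactic True (concat (foldl schensted_insert T (x # w))) (concat (schensted_insert T x) @ w)"
    by simp
  also have "plactic True \<dots> ((concat T @ [x]) @ w)" using i by (intro plactic_suffix) simp
  finally show ?case using Cons.IH[of "schensted_insert T x"] i by simp
qed simp

lemma tableau_mult:
  assumes "T \<in> YT A" "T' \<in> YT A"
  shows "T \<ast> T' \<in> YT A" "plactic True (concat (T \<ast> T')) (concat T @ concat T')"
proof -
  have p: "tableau True (T \<ast> T') \<and> plactic True (concat (T \<ast> T')) (concat T @ concat T')"
    unfolding tableau_mult_def using assms by (intro foldl_schensted_insert) (simp add: YT_iff)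
  then show "plactic True (concat (T \<ast> T')) (concat T @ concat T')" ..
  from p plactic_set[OF conjunct2[OF p]] assms show "T \<ast> T' \<in> YT A"
    by (auto simp: YT_iff)
qed

lemma tableau_mult_unique:
  assumes "T1 \<in> YT A" "T2 \<in> YT A" "tableau True T" "plactic True (concat T) (concat T1 @ concat T2)"
  shows "T = T1 \<ast> T2"
  using assms tableau_mult[OF assms(1,2)]
  by (intro tableau_unique[of True]) (auto simp: YT_iff intro: plactic.sym plactic.trans)

section \<open>Transposition\<close>

text \<open>Row lengths grow downwards, whereas \<open>transpose\<close> behaves as an involution
  when they do not increase along the list. One therefore works with \<open>rev T\<close> and
  returns to \<open>columns T\<close> by this identity.\<close>

lemma transpose_rev: "transpose (rev T) = map rev (transpose T)"
proof (rule nth_equalityI)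
  have "foldr (\<lambda>xs. max (length xs)) (rev T) 0 = foldr (\<lambda>xs. max (length xs)) T 0"
    by (subst (2) foldr_fold) (auto simp: foldr_conv_fold fun_eq_iff)
  then show len: "length (transpose (rev T)) = length (map rev (transpose T))"
    by (simp add: length_transpose)
  fix i assume "i < length (transpose (rev T))"
  then show "transpose (rev T) ! i = map rev (transpose T) ! i"
    using len by (simp add: nth_transpose rev_filter rev_map)
qed

lemma tableau_sorted_lengths:
  assumes "successively (dominates s) T"
  shows "sorted (map length T)"
proof -
  have "successively (\<lambda>x y. length x \<le> length y) T"
    using assms by (rule successively_mono) (auto simp: dominates_iff_nth)
  then have "successively (\<le>) (map length T)" by (simp add: successively_map)
  then show ?thesis by (simp add: successively_conv_sorted_wrt)
qed

text \<open>This is reflection in the diagonal. The list \<open>B\<close> has the rows from bottom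
  to top, so its columns are read upwards, and the outer \<open>rev\<close> makes the leftmost
  column the bottom row.\<close>

lemma tableau_transpose:
  assumes "tableau s T"
  shows "tableau (\<not> s) (rev (transpose (rev T)))"
proof -
  define B where "B = rev T"
  have sorted: "sorted (rev (map length B))"
    using tableau_sorted_lengths assms by (auto simp: B_def tableau_def rev_map)
  have rows: "row s (B ! j) \<and> B ! j \<noteq> []" if "j < length B" for j
    using assms nth_mem[OF that] by (auto simp: tableau_def B_def)
  have dom: "dominates s (B ! Suc j) (B ! j)" if "Suc j < length B" for j
  proof -
    have "successively (\<lambda>x y. dominates s y x) B" using assms by (simp add: B_def tableau_def)
    from successively_nth[OF this that] show ?thesis .
  qed
  have len: "length (transpose B ! i) = length (filter (\<lambda>r. i < length r) B)"
    if "i < length (transpose B)" for i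
    using that by (simp add: nth_transpose)
  \<comment> \<open>The rows of \<open>B\<close> reaching column \<open>i\<close> form an initial
    segment, so entry \<open>j\<close> of that column comes from row \<open>j\<close>.\<close>
  have mem: "j < length B \<and> i < length (B ! j)" if "j < length (filter (\<lambda>r. i < length r) B)" for i j
  proof -
    have eq: "filter (\<lambda>r. i < length r) B = takeWhile (\<lambda>r. i < length r) B"
      by (rule filter_equals_takeWhile_sorted_rev[OF sorted])
    then have j: "j < length (takeWhile (\<lambda>r. i < length r) B)" using that by simp
    then have "i < length (takeWhile (\<lambda>r. i < length r) B ! j)"
      by (metis nth_mem set_takeWhileD)
    then show ?thesis using j takeWhile_nth[OF j] length_takeWhile_le[of "\<lambda>r. i < length r" B] by simp
  qed
  have entry: "transpose B ! i ! j = B ! j ! i"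
    if "i < length (transpose B)" "j < length (transpose B ! i)" for i j
    using that len sorted by simp
  have "transpose B ! i \<noteq> []" if "i < length (transpose B)" for i
  proof -
    have "B \<noteq> []" "i < length (B ! 0)"
      using that length_transpose_sorted[OF sorted] by (auto split: if_splits)
    then have "B ! 0 \<in> set (filter (\<lambda>r. i < length r) B)" by simp
    then have "length (transpose B ! i) > 0" unfolding len[OF that] by (metis length_pos_if_in_set)
    then show ?thesis by simp
  qed
  moreover have "row (\<not> s) (transpose B ! i)" if i: "i < length (transpose B)" for i
  proof -
    have "successively (leq (\<not> s)) (transpose B ! i)"
      unfolding successively_conv_nth
    proof (intro allI impI)
      fix j assume j: "Suc j < length (transpose B ! i)"
      then have "Suc j < length B" "i < length (B ! Suc j)" using mem len[OF i] by auto
      then have "leq (\<not> s) (B ! j ! i) (B ! Suc j ! i)"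
        using dom[of j] by (auto simp: dominates_iff_nth)
      then show "leq (\<not> s) (transpose B ! i ! j) (transpose B ! i ! Suc j)"
        using entry[OF i] j by simp
    qed
    then show ?thesis by (simp add: successively_conv_sorted_wrt transp_leq)
  qed
  moreover have "dominates (\<not> s) (transpose B ! Suc i) (transpose B ! i)"
    if i: "Suc i < length (transpose B)" for i
    unfolding dominates_iff_nth
  proof (intro conjI allI impI)
    have "length (filter (\<lambda>r. Suc i < length r) B) \<le> length (filter (\<lambda>r. i < length r) B)"
      by (induction B) auto
    then show le: "length (transpose B ! Suc i) \<le> length (transpose B ! i)"
      using len i by simp
    fix j assume j: "j < length (transpose B ! Suc i)"
    then have "j < length B" "Suc i < length (B ! j)" using mem len[OF i] by auto
    then have "leq s (B ! j ! i) (B ! j ! Suc i)"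
      using rows by (auto simp: sorted_wrt_iff_nth_less)
    then show "leq (\<not> \<not> s) (transpose B ! i ! j) (transpose B ! Suc i ! j)"
      using entry[of i j] entry[OF i j] le i j by simp
  qed
  then have "successively (\<lambda>x y. dominates (\<not> s) y x) (transpose B)"
    unfolding successively_conv_nth by blast
  ultimately show ?thesis
    by (auto simp: tableau_def B_def[symmetric] in_set_conv_nth)
qed

lemma transpose_involution:
  assumes "tableau s T"
  shows "rev (transpose (rev (rev (transpose (rev T))))) = T"
proof -
  have "transpose (transpose (rev T)) = takeWhile (\<lambda>x. x \<noteq> []) (rev T)"
    using tableau_sorted_lengths assms by (intro transpose_transpose) (auto simp: tableau_def rev_map)
  also have "\<dots> = rev T" using assms by (auto simp: tableau_def takeWhile_eq_all_conv)
  finally show ?thesis by simp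
qed

lemma tableau_columns: "tableau s T \<Longrightarrow> tableau (\<not> s) (rev (map rev (transpose T)))"
  using tableau_transpose[of s T] by (simp add: transpose_rev)

lemma columns_inject:
  assumes "tableau s T" "tableau s T'" "transpose T = transpose T'"
  shows "T = T'"
  using transpose_involution[OF assms(1)] transpose_involution[OF assms(2)] assms(3)
  by (simp add: transpose_rev)

lemma columns_surject:
  assumes "tableau (\<not> s) (rev (map rev cs))"
  obtains T where "tableau s T" "transpose T = cs"
proof
  let ?T = "rev (transpose (map rev cs))"
  show "tableau s ?T" using tableau_transpose[OF assms] by simp
  have "rev (transpose (rev ?T)) = rev (map rev cs)"
    using transpose_involution[OF assms] by simp
  then show "transpose ?T = cs"
    by (simp add: transpose_rev inj_map_eq_map[OF inj_on_rev])
qed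

lemma length_columns:
  assumes "tableau s T"
  shows "length (transpose T) = cols T"
proof -
  have "length (transpose T) = length (transpose (rev T))" by (simp add: transpose_rev)
  also have "\<dots> = cols T"
    using tableau_sorted_lengths[of s T] assms length_transpose_sorted[of "rev T"]
    by (simp add: tableau_def rev_map cols_def rev_nth last_conv_nth)
  finally show ?thesis .
qed

section \<open>Row reading and column reading are plactically equivalent\<close>

lemma plactic_slide_word:
  "\<lbrakk>row s (p # t); sorted_wrt (\<lambda>x y. leq (\<not> s) y x) (p # c)\<rbrakk> \<Longrightarrow>
    plactic s (p # t @ c) (p # c @ t)"
proof (induction c arbitrary: p)
  case (Cons d c)
  then have "leq (\<not> s) d p" by simp
  \<comment> \<open>As \<open>d\<close> comes before \<open>p\<close>, it can replace
    \<open>p\<close> in front of \<open>t\<close>, and the induction continues with \<open>d\<close>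
    in the role of \<open>p\<close>.\<close>
  have "row s (d # t)" using Cons.prems by (auto intro: leq_trans_mixed)
  with Cons have "plactic s (d # t @ c) (d # c @ t)" by simp
  have "plactic s ((p # t @ [d]) @ c) ((p # d # t) @ c)"
    using plactic_slide[OF Cons.prems(1) \<open>leq (\<not> s) d p\<close>] by (rule plactic_suffix)
  also have "plactic s ((p # d # t) @ c) ([p] @ d # c @ t)"
    using plactic_prefix[OF \<open>plactic s (d # t @ c) (d # c @ t)\<close>, of "[p]"] by simp
  finally show ?case by simp
qed simp

lemma dominates_hd_tl:
  "dominates s u v \<Longrightarrow> u \<noteq> [] \<Longrightarrow> leq (\<not> s) (hd v) (hd u) \<and> dominates s (tl u) (tl v)"
  by (cases u; cases v) auto

text \<open>By induction, the heads of the lower rows have been gathered in front of their tails.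
  Together with \<open>x\<close> they form a decreasing word, which slides past the tail of the top
  row.\<close>

lemma plactic_first_column:
  "tableau s T \<Longrightarrow> plactic s (concat T) (map hd T @ concat (map tl T))"
proof (induction T)
  case (Cons r T)
  then have T: "tableau s T" by (auto simp: tableau_def successively_Cons)
  obtain x t where r: "r = x # t" using Cons.prems by (cases r) (auto simp: tableau_def)
  have "successively (\<lambda>u v. leq (\<not> s) (hd v) (hd u)) (r # T)"
  proof (rule successively_mono)
    show "successively (dominates s) (r # T)" using Cons.prems by (simp add: tableau_def)
    fix u v assume "u \<in> set (r # T)" "v \<in> set (r # T)" "dominates s u v"
    moreover from this have "u \<noteq> []" using Cons.prems by (auto simp: tableau_def)
    ultimately show "leq (\<not> s) (hd v) (hd u)" using dominates_hd_tl by blast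
  qed
  then have "successively (\<lambda>u v. leq (\<not> s) v u) (map hd (r # T))"
    by (simp add: successively_map del: list.map)
  then have "sorted_wrt (\<lambda>u v. leq (\<not> s) v u) (x # map hd T)"
    using r by (simp add: successively_conv_sorted_wrt transp_leq del: sorted_wrt.simps)
  then have slide: "plactic s (x # t @ map hd T) (x # map hd T @ t)"
    using Cons.prems r by (intro plactic_slide_word) (auto simp: tableau_def)
  have "plactic s (concat (r # T)) ((x # t @ map hd T) @ concat (map tl T))"
    using plactic_prefix[OF Cons.IH[OF T], of "x # t"] r by simp
  also have "plactic s \<dots> ((x # map hd T @ t) @ concat (map tl T))"
    by (rule plactic_suffix[OF slide])
  finally show ?case using r by simp
qed simp

lemma transpose_first_column:
  assumes "\<forall>r\<in>set T. r \<noteq> []" "T \<noteq> []"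
  shows "transpose T = map hd T # transpose (map tl T)"
proof (cases T)
  case (Cons r T')
  then obtain x t where "r = x # t" using assms by (cases r) auto
  then show ?thesis
    using assms Cons by (simp add: transpose_aux_filter_head transpose_aux_filter_tail)
qed (use assms in simp)

text \<open>First columns are split off one by one. Doing so may empty the topmost rows, which is
  why the statement is about chains and not about tableaux.\<close>

lemma plactic_columns:
  "\<lbrakk>\<forall>r\<in>set T. row s r; successively (dominates s) T\<rbrakk> \<Longrightarrow>
    plactic s (concat (transpose T)) (concat T)"
proof (induction T rule: transpose.induct)
  case (2 T)
  then show ?case by (auto simp: successively_Cons)
next
  case (3 x t T)
  let ?T = "(x # t) # T"
  obtain k U where "?T = replicate k [] @ U" and U: "tableau s U"
    using row_chain_cases[OF 3(2,3)] .
  then have T: "tableau s ?T" by (cases k) auto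
  then have ne: "\<forall>r\<in>set ?T. r \<noteq> []" by (simp add: tableau_def)
  then have tl: "t # [t. (h # t) \<leftarrow> T] = map tl ?T"
    by (simp add: transpose_aux_filter_tail)
  have "successively (\<lambda>u v. dominates s (tl u) (tl v)) ?T"
  proof (rule successively_mono[OF 3(3)])
    fix u v assume "u \<in> set ?T" "v \<in> set ?T" "dominates s u v"
    then show "dominates s (tl u) (tl v)" using ne dominates_hd_tl by blast
  qed
  then have "successively (dominates s) (map tl ?T)" by (simp only: successively_map)
  moreover have "row s (tl r)" if "row s r" for r :: "'a list"
    using that by (cases r) auto
  then have "\<forall>r\<in>set (map tl ?T). row s r" using 3(2) by auto
  ultimately have "plactic s (concat (transpose (map tl ?T))) (concat (map tl ?T))"
    using 3(1) unfolding tl by blast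
  from plactic_prefix[OF this, of "map hd ?T"]
  have "plactic s (concat (transpose ?T)) (map hd ?T @ concat (map tl ?T))"
    by (subst transpose_first_column[OF ne]) simp_all
  also have "plactic s \<dots> (concat ?T)" by (rule plactic.sym[OF plactic_first_column[OF T]])
  finally show ?case .
qed simp

lemma plactic_tableau_columns: "tableau s T \<Longrightarrow> plactic s (concat (transpose T)) (concat T)"
  by (intro plactic_columns) (auto simp: tableau_def)

text \<open>Read upwards, a column is a row for the other order, and of two adjacent columns the
  right one dominates. So the order of the columns and each single column have to be reversed, by
  \<open>dual\<close> and \<open>transport\<close>; together this reverses the concatenated word,
  and \<open>plactic_rev_iff\<close> returns to the original congruence.\<close>

lemma normal_forms_columns:
  "normal_forms (\<lambda>c. row (\<not> s) (rev c)) (\<lambda>c d. dominates (\<not> s) (rev d) (rev c))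
    (\<lambda>xs ys. plactic s (concat xs) (concat ys))"
proof -
  have "concat (rev (map rev xs)) = rev (concat xs)" for xs :: "'a list list"
    by (simp add: rev_concat rev_map)
  then have "plactic (\<not> s) (concat (rev (map rev xs))) (concat (rev (map rev ys)))
      \<longleftrightarrow> plactic s (concat xs) (concat ys)" for xs ys :: "'a list list"
    by (simp add: plactic_rev_iff)
  with normal_forms.transport[OF normal_forms.dual[OF normal_forms_rows[of "\<not> s"]], of "rev :: 'a list \<Rightarrow> _"]
  show ?thesis by (simp add: involuntory_imp_bij)
qed

section \<open>The two braided commutative monoids\<close>

text \<open>
  The counter of \<open>(T, a)\<close> is the number of empty rows on top of \<open>T\<close>, respectively of empty
  columns to the right of it.
\<close>

definition enc_R :: "'a list list \<times> nat \<Rightarrow> 'a list list" where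
  "enc_R = (\<lambda>(T, a). replicate a [] @ T)"

definition enc_C :: "'a list list \<times> nat \<Rightarrow> 'a list list" where
  "enc_C = (\<lambda>(T, a). columns T @ replicate a [])"

interpretation R: normal_forms "row True" "dominates True"
  "\<lambda>xs ys :: 'a::linorder list list. plactic True (concat xs) (concat ys)"
  by (rule normal_forms_rows)

interpretation C: normal_forms "\<lambda>c. row False (rev c)" "\<lambda>c d. dominates False (rev d) (rev c)"
  "\<lambda>xs ys :: 'a::linorder list list. plactic True (concat xs) (concat ys)"
  using normal_forms_columns[of True] by simp

section \<open>Tableaux with a counter as chains of rows and of columns\<close>

lemma chain_R_iff: "R.chain xs \<longleftrightarrow> (\<forall>r\<in>set xs. row True r) \<and> successively (dominates True) xs"
  by (simp add: R.chain_def list_all_iff)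

lemma chain_C_iff:
  "C.chain xs \<longleftrightarrow> (\<forall>r\<in>set (rev (map rev xs)). row False r) \<and>
    successively (dominates False) (rev (map rev xs))"
  by (simp add: C.chain_def list_all_iff successively_map)

lemma enc_R_inject: "T \<in> YT A \<Longrightarrow> T' \<in> YT A \<Longrightarrow> enc_R (T, a) = enc_R (T', a') \<longleftrightarrow> (T, a) = (T', a')"
  using replicate_append_eq_iff[of T "[]" T' a a']
  by (auto simp: enc_R_def YT_iff tableau_def)

lemma chain_enc_R: "T \<in> YT A \<Longrightarrow> R.chain (enc_R (T, a))"
  using tableau_pad[of True T a] by (simp add: enc_R_def YT_iff chain_R_iff)

lemma length_enc_R: "length (enc_R (T, a)) = a + rows T"
  by (simp add: enc_R_def rows_def)

lemma concat_enc_R: "concat (enc_R (T, a)) = concat T"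
  by (simp add: enc_R_def)

lemma enc_R_surject:
  assumes "R.chain xs" "set (concat xs) \<subseteq> A"
  obtains T a where "T \<in> YT A" "enc_R (T, a) = xs"
proof -
  obtain k T where "xs = replicate k [] @ T" "tableau True T"
    using row_chain_cases[of xs True] assms(1) by (auto simp: chain_R_iff)
  then show thesis using that[of T k] assms(2) by (auto simp: enc_R_def YT_iff)
qed

lemma set_concat_enc_R: "T \<in> YT A \<Longrightarrow> set (concat (enc_R (T, a))) = set (concat T)"
  by (simp add: concat_enc_R)

lemma columns_nonempty: "tableau s T \<Longrightarrow> [] \<notin> set (columns T)"
  using tableau_columns[of s T] by (auto simp: tableau_def)

lemma enc_C_inject: "T \<in> YT A \<Longrightarrow> T' \<in> YT A \<Longrightarrow> enc_C (T, a) = enc_C (T', a') \<longleftrightarrow> (T, a) = (T', a')"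
proof
  assume T: "T \<in> YT A" "T' \<in> YT A" and eq: "enc_C (T, a) = enc_C (T', a')"
  then have "rev (enc_C (T, a)) = rev (enc_C (T', a'))" by simp
  then have "replicate a [] @ rev (columns T) = replicate a' [] @ rev (columns T')"
    by (simp add: enc_C_def)
  then have "a = a' \<and> rev (columns T) = rev (columns T')"
    using replicate_append_eq_iff[of "rev (columns T)" "[]" "rev (columns T')"]
      columns_nonempty[of True T] columns_nonempty[of True T'] T
    by (metis YT_iff set_rev)
  then show "(T, a) = (T', a')" using columns_inject[of True T T'] T by (simp add: YT_iff)
qed simp

lemma chain_enc_C: "T \<in> YT A \<Longrightarrow> C.chain (enc_C (T, a))"
  using tableau_pad[OF tableau_columns, of True T a] by (simp add: enc_C_def YT_iff chain_C_iff)

lemma length_enc_C: "T \<in> YT A \<Longrightarrow> length (enc_C (T, a)) = a + cols T"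
  using length_columns[of True T] by (simp add: enc_C_def YT_iff)

lemma concat_enc_C: "T \<in> YT A \<Longrightarrow> plactic True (concat (enc_C (T, a))) (concat T)"
  using plactic_tableau_columns[of True T] by (simp add: enc_C_def YT_iff)

lemma set_concat_enc_C: "T \<in> YT A \<Longrightarrow> set (concat (enc_C (T, a))) = set (concat T)"
  by (rule plactic_set[OF concat_enc_C])

lemma enc_C_surject:
  assumes "C.chain xs" "set (concat xs) \<subseteq> A"
  obtains T a where "T \<in> YT A" "enc_C (T, a) = xs"
proof -
  obtain k D where D: "rev (map rev xs) = replicate k [] @ D" "tableau False D"
    using row_chain_cases[of "rev (map rev xs)" False] assms(1) by (auto simp: chain_C_iff)
  from arg_cong[OF D(1), of "\<lambda>ys. map rev (rev ys)"]
  have xs: "xs = map rev (rev D) @ replicate k []" by (simp add: rev_map)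
  have "rev (map rev (map rev (rev D))) = D" by (simp add: rev_map)
  then obtain T where T: "tableau True T" "columns T = map rev (rev D)"
    using columns_surject[of True "map rev (rev D)"] D(2) by auto
  have "set (concat T) = set (concat xs)"
    using plactic_set[OF plactic_tableau_columns[OF T(1)]] T(2) xs by simp
  with T(1) assms(2) have "T \<in> YT A" by (simp add: YT_iff)
  moreover have "enc_C (T, k) = xs" using T(2) xs by (simp add: enc_C_def)
  ultimately show thesis by (rule that)
qed

text \<open>Merging yields a chain of the full length, and its tableau part is the product by
  uniqueness. The number of its empty rows is the counter of the product, so the subtraction in
  \<open>YT_R\<close> cannot truncate.\<close>

lemma enc_R_normal_form:
  assumes "T1 \<in> YT A" "T2 \<in> YT A"
  shows "\<exists>k. length (enc_R (T1 \<ast> T2, k)) = length (enc_R (T1, a1)) + length (enc_R (T2, a2))"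
proof -
  let ?ys = "enc_R (T1, a1) @ enc_R (T2, a2)"
  have "list_all (row True) ?ys"
    using chain_enc_R[OF assms(1), of a1] chain_enc_R[OF assms(2), of a2] by (simp add: R.chain_def)
  then obtain xs where xs: "R.chain xs" "length xs = length ?ys" "plactic True (concat xs) (concat ?ys)"
    using R.chain_exists by blast
  obtain T k where T: "T \<in> YT UNIV" "enc_R (T, k) = xs" using enc_R_surject[OF xs(1), of UNIV] by blast
  then have "T = T1 \<ast> T2"
    using xs(3) concat_enc_R[of T k] by (intro tableau_mult_unique[OF assms]) (auto simp: concat_enc_R YT_iff)
  then show ?thesis using T xs(2) by auto
qed

lemma enc_C_normal_form:
  assumes "T1 \<in> YT A" "T2 \<in> YT A"
  shows "\<exists>k. length (enc_C (T1 \<ast> T2, k)) = length (enc_C (T1, a1)) + length (enc_C (T2, a2))"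
proof -
  let ?ys = "enc_C (T1, a1) @ enc_C (T2, a2)"
  have "list_all (\<lambda>c. row False (rev c)) ?ys"
    using chain_enc_C[OF assms(1), of a1] chain_enc_C[OF assms(2), of a2] by (simp add: C.chain_def)
  then obtain xs where xs: "C.chain xs" "length xs = length ?ys" "plactic True (concat xs) (concat ?ys)"
    using C.chain_exists by blast
  obtain T k where T: "T \<in> YT UNIV" "enc_C (T, k) = xs" using enc_C_surject[OF xs(1), of UNIV] by blast
  have "plactic True (concat T) (concat ?ys)"
    using xs(3) concat_enc_C[OF T(1), of k] T(2) by (auto intro: plactic.sym plactic.trans)
  also have "plactic True (concat ?ys) (concat T1 @ concat T2)"
    using plactic.append[OF concat_enc_C[OF assms(1), of a1] concat_enc_C[OF assms(2), of a2]] by simp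
  finally have "T = T1 \<ast> T2"
    using T(1) by (intro tableau_mult_unique[OF assms]) (auto simp: YT_iff)
  then show ?thesis using T xs(2) by auto
qed

lemma rows_mult_le: "T1 \<in> YT A \<Longrightarrow> T2 \<in> YT A \<Longrightarrow> rows (T1 \<ast> T2) \<le> rows T1 + rows T2"
  using enc_R_normal_form[of T1 A T2 0 0] by (auto simp: length_enc_R)

lemma cols_mult_le: "T1 \<in> YT A \<Longrightarrow> T2 \<in> YT A \<Longrightarrow> cols (T1 \<ast> T2) \<le> cols T1 + cols T2"
  using enc_C_normal_form[of T1 A T2 0 0] tableau_mult(1)[of T1 A T2] by (auto simp: length_enc_C)

section \<open>The braidings as cuts of normal forms\<close>

lemma filter_nonempty: "[] \<notin> set xs \<Longrightarrow> filter (\<lambda>r. r \<noteq> []) xs = xs"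
  by (induction xs) auto

text \<open>An empty row in the lower piece forces every row of the upper piece to be empty. This is
  the condition \<open>T2' = []\<close>; the rest of the characterisation is a comparison of
  lengths.\<close>

lemma is_braid_R_iff:
  assumes "T1 \<in> YT A" "T2 \<in> YT A"
  shows "is_braid_R A ((T1, a1), (T2, a2)) ((T2', a2'), (T1', a1')) \<longleftrightarrow>
    T1' \<in> YT A \<and> T2' \<in> YT A \<and>
    R.is_split (enc_R (T1, a1)) (enc_R (T2, a2)) (enc_R (T2', a2')) (enc_R (T1', a1'))"
    (is "?braid \<longleftrightarrow> _ \<and> _ \<and> ?split")
proof (intro iffI conjI)
  assume b: ?braid
  then show "T1' \<in> YT A" "T2' \<in> YT A" by auto
  have eq: "T2' @ T1' = T1 \<ast> T2" and z: "a1' = 0 \<or> T2' = []" using b by auto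
  have "enc_R (T2', a2') @ enc_R (T1', a1') = enc_R (T1 \<ast> T2, a2' + a1')"
    using z eq by (auto simp: enc_R_def replicate_add)
  then have "R.chain (enc_R (T2', a2') @ enc_R (T1', a1'))"
    using chain_enc_R[OF tableau_mult(1)[OF assms]] by simp
  moreover have "plactic True (concat (T2' @ T1')) (concat T1 @ concat T2)"
    using tableau_mult(2)[OF assms] eq by simp
  ultimately show ?split
    using b by (simp add: R.is_split_def length_enc_R concat_enc_R)
next
  assume "T1' \<in> YT A \<and> T2' \<in> YT A \<and> ?split"
  then have T: "T1' \<in> YT A" "T2' \<in> YT A" and split: ?split by auto
  let ?xs = "enc_R (T2', a2') @ enc_R (T1', a1')"
  have ch: "R.chain ?xs" using split by (simp add: R.is_split_def)
  then obtain T k where Tk: "T \<in> YT UNIV" "enc_R (T, k) = ?xs" by (rule enc_R_surject[of _ UNIV]) auto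
  have "plactic True (concat T) (concat T1 @ concat T2)"
    using split arg_cong[OF Tk(2), of concat] by (simp add: R.is_split_def concat_enc_R)
  then have T': "T = T1 \<ast> T2"
    using Tk by (intro tableau_mult_unique[OF assms]) (auto simp: YT_iff)
  have ne: "[] \<notin> set T" "[] \<notin> set T1'" "[] \<notin> set T2'"
    using Tk(1) T by (auto simp: YT_iff tableau_def)
  from arg_cong[OF Tk(2), of "filter (\<lambda>r. r \<noteq> [])"]
  have eq: "T2' @ T1' = T1 \<ast> T2"
    using ne T' by (simp add: enc_R_def filter_nonempty)
  have z: "T2' = []" if "a1' > 0"
  proof (rule ccontr)
    assume "T2' \<noteq> []"
    moreover from that have "enc_R (T1', a1') \<noteq> []" "hd (enc_R (T1', a1')) = []"
      by (auto simp: enc_R_def hd_append gr0_conv_Suc)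
    ultimately have "dominates True (last T2') []"
      using ch by (auto simp: R.chain_append enc_R_def)
    then show False using \<open>T2' \<noteq> []\<close> ne by (metis dominates_Nil_right last_in_set)
  qed
  have "rows (T1 \<ast> T2) = rows T2' + rows T1'" using eq by (metis rows_def length_append)
  moreover have len: "a1' + rows T1' = a1 + rows T1" "a2' + rows T2' = a2 + rows T2"
    using split T assms by (simp_all add: R.is_split_def length_enc_R)
  \<comment> \<open>If \<open>a1' > 0\<close>, the product is all of \<open>T1'\<close> and falls
    short of the lower piece by \<open>a1'\<close> rows; if \<open>a1' = 0\<close>, the lower piece
    consists of rows of the product only.\<close>
  ultimately have "a1' > 0 \<longleftrightarrow> rows (T1 \<ast> T2) < a1 + rows T1"
    using z by (cases "a1' > 0") (simp_all add: rows_def)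
  then show ?braid using T eq z len by simp
qed

text \<open>Empty columns gather on the right, so here an empty column in the left piece forces the
  right piece to be empty.\<close>

lemma is_braid_C_iff:
  assumes "T1 \<in> YT A" "T2 \<in> YT A"
  shows "is_braid_C A ((T1, a1), (T2, a2)) ((T2', a2'), (T1', a1')) \<longleftrightarrow>
    T1' \<in> YT A \<and> T2' \<in> YT A \<and>
    C.is_split (enc_C (T1, a1)) (enc_C (T2, a2)) (enc_C (T2', a2')) (enc_C (T1', a1'))"
    (is "?braid \<longleftrightarrow> _ \<and> _ \<and> ?split")
proof (intro iffI conjI)
  assume b: ?braid
  then show T: "T1' \<in> YT A" "T2' \<in> YT A" by auto
  have eq: "columns T2' @ columns T1' = columns (T1 \<ast> T2)" and z: "a2' = 0 \<or> T1' = []"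
    using b by auto
  have enc: "enc_C (T2', a2') @ enc_C (T1', a1') = enc_C (T1 \<ast> T2, a2' + a1')"
    using z eq by (auto simp: enc_C_def replicate_add)
  then have ch: "C.chain (enc_C (T2', a2') @ enc_C (T1', a1'))"
    using chain_enc_C[OF tableau_mult(1)[OF assms]] by simp
  have "plactic True (concat (enc_C (T1 \<ast> T2, a2' + a1'))) (concat (T1 \<ast> T2))"
    by (rule concat_enc_C[OF tableau_mult(1)[OF assms]])
  also have "plactic True \<dots> (concat T1 @ concat T2)" by (rule tableau_mult(2)[OF assms])
  also have "plactic True \<dots> (concat (enc_C (T1, a1)) @ concat (enc_C (T2, a2)))"
    by (intro plactic.append plactic.sym[OF concat_enc_C[OF assms(1)]]
        plactic.sym[OF concat_enc_C[OF assms(2)]])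
  finally show ?split
    using b T assms ch enc by (simp add: C.is_split_def length_enc_C[of _ A])
next
  assume "T1' \<in> YT A \<and> T2' \<in> YT A \<and> ?split"
  then have T: "T1' \<in> YT A" "T2' \<in> YT A" and split: ?split by auto
  let ?xs = "enc_C (T2', a2') @ enc_C (T1', a1')"
  have ch: "C.chain ?xs" using split by (simp add: C.is_split_def)
  then obtain T k where Tk: "T \<in> YT UNIV" "enc_C (T, k) = ?xs" by (rule enc_C_surject[of _ UNIV]) auto
  have "plactic True (concat T) (concat ?xs)"
    using concat_enc_C[OF Tk(1), of k] Tk(2) by (auto intro: plactic.sym)
  also have "plactic True \<dots> (concat (enc_C (T1, a1)) @ concat (enc_C (T2, a2)))"
    using split by (simp add: C.is_split_def)
  also have "plactic True \<dots> (concat T1 @ concat T2)"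
    by (intro plactic.append concat_enc_C[OF assms(1)] concat_enc_C[OF assms(2)])
  finally have T': "T = T1 \<ast> T2"
    using Tk by (intro tableau_mult_unique[OF assms]) (auto simp: YT_iff)
  have ne: "[] \<notin> set (columns T)" "[] \<notin> set (columns T1')" "[] \<notin> set (columns T2')"
    using Tk(1) T columns_nonempty by (auto simp: YT_iff)
  from arg_cong[OF Tk(2), of "filter (\<lambda>r. r \<noteq> [])"]
  have eq: "columns T2' @ columns T1' = columns (T1 \<ast> T2)"
    using ne T' by (simp add: enc_C_def filter_nonempty)
  have col0: "columns T1' = [] \<longleftrightarrow> T1' = []"
    using T(1) by (cases T1') (auto simp: transpose_empty YT_iff tableau_def)
  have z: "T1' = []" if "a2' > 0"
  proof (rule ccontr)
    assume "T1' \<noteq> []"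
    then have T1': "columns T1' \<noteq> []" using col0 by simp
    moreover from that have "enc_C (T2', a2') \<noteq> []" "last (enc_C (T2', a2')) = []"
      by (auto simp: enc_C_def)
    ultimately have "dominates False (rev (hd (columns T1'))) []"
      using ch by (auto simp: C.chain_append enc_C_def)
    then show False using T1' ne(2) by (metis dominates_Nil_right hd_in_set rev_is_Nil_conv)
  qed
  have "cols (T1 \<ast> T2) = cols T2' + cols T1'"
    using eq T tableau_mult(1)[OF assms] length_columns[of True]
    by (metis YT_iff length_append)
  moreover have len: "a1' + cols T1' = a1 + cols T1" "a2' + cols T2' = a2 + cols T2"
    using split T assms by (simp_all add: C.is_split_def length_enc_C[of _ A])
  ultimately have "a2' > 0 \<longleftrightarrow> cols (T1 \<ast> T2) < a2 + cols T2"
    using z by (cases "a2' > 0") (simp_all add: cols_def)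
  then show ?braid using T eq z len by simp
qed

lemma ex1_braid_R:
  assumes "T1 \<in> YT A" "T2 \<in> YT A"
  shows "\<exists>!q. is_braid_R A ((T1, a1), (T2, a2)) q"
proof -
  obtain us vs where split: "R.is_split (enc_R (T1, a1)) (enc_R (T2, a2)) us vs"
    using R.split_exists[OF chain_enc_R chain_enc_R] assms by blast
  then have ch: "R.chain us" "R.chain vs" by (auto simp: R.is_split_def R.chain_append)
  have "plactic True (concat us @ concat vs) (concat (enc_R (T1, a1)) @ concat (enc_R (T2, a2)))"
    using split by (simp add: R.is_split_def)
  \<comment> \<open>The congruence preserves the set of letters, so both pieces are again over
    \<open>A\<close>.\<close>
  from plactic_set[OF this] have "set (concat us) \<union> set (concat vs) \<subseteq> A"
    using assms set_concat_enc_R[OF assms(1)] set_concat_enc_R[OF assms(2)]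
    by (simp add: YT_iff del: set_concat)
  then have "set (concat us) \<subseteq> A" "set (concat vs) \<subseteq> A" by blast+
  then obtain T2' a2' T1' a1' where
    u: "T2' \<in> YT A" "enc_R (T2', a2') = us" and v: "T1' \<in> YT A" "enc_R (T1', a1') = vs"
    using enc_R_surject ch by metis
  show ?thesis
  proof (rule ex1I)
    show "is_braid_R A ((T1, a1), (T2, a2)) ((T2', a2'), (T1', a1'))"
      using u v split by (simp add: is_braid_R_iff[OF assms] del: is_braid_R.simps)
    fix q assume q: "is_braid_R A ((T1, a1), (T2, a2)) q"
    obtain S2 b2 S1 b1 where eq: "q = ((S2, b2), (S1, b1))" by (metis surj_pair)
    from q have S: "S1 \<in> YT A" "S2 \<in> YT A"
      "R.is_split (enc_R (T1, a1)) (enc_R (T2, a2)) (enc_R (S2, b2)) (enc_R (S1, b1))"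
      unfolding eq is_braid_R_iff[OF assms] by auto
    then show "q = ((T2', a2'), (T1', a1'))"
      using R.split_unique[OF S(3) split] u v enc_R_inject[of S2 A T2'] enc_R_inject[of S1 A T1'] eq
      by auto
  qed
qed

lemma ex1_braid_C:
  assumes "T1 \<in> YT A" "T2 \<in> YT A"
  shows "\<exists>!q. is_braid_C A ((T1, a1), (T2, a2)) q"
proof -
  obtain us vs where split: "C.is_split (enc_C (T1, a1)) (enc_C (T2, a2)) us vs"
    using C.split_exists[OF chain_enc_C chain_enc_C] assms by blast
  then have ch: "C.chain us" "C.chain vs" by (auto simp: C.is_split_def C.chain_append)
  have "plactic True (concat us @ concat vs) (concat (enc_C (T1, a1)) @ concat (enc_C (T2, a2)))"
    using split by (simp add: C.is_split_def)
  from plactic_set[OF this] have "set (concat us) \<union> set (concat vs) \<subseteq> A"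
    using assms set_concat_enc_C[OF assms(1)] set_concat_enc_C[OF assms(2)]
    by (simp add: YT_iff del: set_concat)
  then have "set (concat us) \<subseteq> A" "set (concat vs) \<subseteq> A" by blast+
  then obtain T2' a2' T1' a1' where
    u: "T2' \<in> YT A" "enc_C (T2', a2') = us" and v: "T1' \<in> YT A" "enc_C (T1', a1') = vs"
    using enc_C_surject ch by metis
  show ?thesis
  proof (rule ex1I)
    show "is_braid_C A ((T1, a1), (T2, a2)) ((T2', a2'), (T1', a1'))"
      using u v split by (simp add: is_braid_C_iff[OF assms] del: is_braid_C.simps)
    fix q assume q: "is_braid_C A ((T1, a1), (T2, a2)) q"
    obtain S2 b2 S1 b1 where eq: "q = ((S2, b2), (S1, b1))" by (metis surj_pair)
    from q have S: "S1 \<in> YT A" "S2 \<in> YT A"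
      "C.is_split (enc_C (T1, a1)) (enc_C (T2, a2)) (enc_C (S2, b2)) (enc_C (S1, b1))"
      unfolding eq is_braid_C_iff[OF assms] by auto
    then show "q = ((T2', a2'), (T1', a1'))"
      using C.split_unique[OF S(3) split] u v enc_C_inject[of S2 A T2'] enc_C_inject[of S1 A T1'] eq
      by auto
  qed
qed

lemma braided_commutative_monoid_R: "braided_commutative_monoid (YT_R A) (\<sigma>\<^sub>R A)"
proof (rule R.braided_commutative_monoidI[where enc = enc_R])
  show "inj_on enc_R (carrier (YT_R A))"
    by (rule inj_onI) (auto simp: YT_R_def enc_R_inject[of _ A])
  show "\<one>\<^bsub>YT_R A\<^esub> \<in> carrier (YT_R A)" "enc_R \<one>\<^bsub>YT_R A\<^esub> = []"
    by (auto simp: YT_R_def YT_iff enc_R_def)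
  show "R.chain (enc_R x)" if "x \<in> carrier (YT_R A)" for x
    using that by (auto simp: YT_R_def chain_enc_R)
next
  fix x y assume "x \<in> carrier (YT_R A)" "y \<in> carrier (YT_R A)"
  then obtain T1 a1 T2 a2 where
    x: "x = (T1, a1)" "T1 \<in> YT A" and y: "y = (T2, a2)" "T2 \<in> YT A"
    by (auto simp: YT_R_def)
  show "x \<otimes>\<^bsub>YT_R A\<^esub> y \<in> carrier (YT_R A) \<and>
      length (enc_R (x \<otimes>\<^bsub>YT_R A\<^esub> y)) = length (enc_R x) + length (enc_R y) \<and>
      plactic True (concat (enc_R (x \<otimes>\<^bsub>YT_R A\<^esub> y))) (concat (enc_R x @ enc_R y))"
    using tableau_mult[OF x(2) y(2)] rows_mult_le[OF x(2) y(2)] x(1) y(1)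
    by (simp add: YT_R_def length_enc_R concat_enc_R)
  fix x' y' assume s: "\<sigma>\<^sub>R A (x, y) = (y', x')"
  have "is_braid_R A (x, y) (\<sigma>\<^sub>R A (x, y))"
    unfolding braid_R_def unfolding x(1) y(1) by (rule theI'[OF ex1_braid_R[OF x(2) y(2)]])
  then show "x' \<in> carrier (YT_R A) \<and> y' \<in> carrier (YT_R A) \<and>
      R.is_split (enc_R x) (enc_R y) (enc_R y') (enc_R x')"
    unfolding s unfolding x(1) y(1) using is_braid_R_iff[OF x(2) y(2)]
    by (cases x'; cases y') (simp add: YT_R_def del: is_braid_R.simps)
qed

lemma braided_commutative_monoid_C: "braided_commutative_monoid (YT_C A) (\<sigma>\<^sub>C A)"
proof (rule C.braided_commutative_monoidI[where enc = enc_C])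
  show "inj_on enc_C (carrier (YT_C A))"
    by (rule inj_onI) (auto simp: YT_C_def enc_C_inject[of _ A])
  show "\<one>\<^bsub>YT_C A\<^esub> \<in> carrier (YT_C A)" "enc_C \<one>\<^bsub>YT_C A\<^esub> = []"
    by (auto simp: YT_C_def YT_iff enc_C_def)
  show "C.chain (enc_C x)" if "x \<in> carrier (YT_C A)" for x
    using that by (auto simp: YT_C_def chain_enc_C)
next
  fix x y assume "x \<in> carrier (YT_C A)" "y \<in> carrier (YT_C A)"
  then obtain T1 a1 T2 a2 where
    x: "x = (T1, a1)" "T1 \<in> YT A" and y: "y = (T2, a2)" "T2 \<in> YT A"
    by (auto simp: YT_C_def)
  obtain b where xy: "x \<otimes>\<^bsub>YT_C A\<^esub> y = (T1 \<ast> T2, b)" and b: "b + cols (T1 \<ast> T2) = a1 + a2 + cols T1 + cols T2"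
    using cols_mult_le[OF x(2) y(2)] x(1) y(1) by (simp add: YT_C_def)
  note T = tableau_mult[OF x(2) y(2)]
  \<comment> \<open>The word of \<open>enc_C\<close> is the column reading, which is only congruent
    to the row reading that defines the product.\<close>
  have "plactic True (concat (enc_C (T1 \<ast> T2, b))) (concat (T1 \<ast> T2))" by (rule concat_enc_C[OF T(1)])
  also have "plactic True \<dots> (concat T1 @ concat T2)" by (rule T(2))
  also have "plactic True \<dots> (concat (enc_C x) @ concat (enc_C y))"
    unfolding x(1) y(1) 
    by (intro plactic.append plactic.sym[OF concat_enc_C[OF x(2)]]
        plactic.sym[OF concat_enc_C[OF y(2)]])
  finally show "x \<otimes>\<^bsub>YT_C A\<^esub> y \<in> carrier (YT_C A) \<and>
      length (enc_C (x \<otimes>\<^bsub>YT_C A\<^esub> y)) = length (enc_C x) + length (enc_C y) \<and>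
      plactic True (concat (enc_C (x \<otimes>\<^bsub>YT_C A\<^esub> y))) (concat (enc_C x @ enc_C y))"
    unfolding xy using T(1) b x y by (simp add: YT_C_def length_enc_C[of _ A])
  fix x' y' assume s: "\<sigma>\<^sub>C A (x, y) = (y', x')"
  have "is_braid_C A (x, y) (\<sigma>\<^sub>C A (x, y))"
    unfolding braid_C_def unfolding x(1) y(1) by (rule theI'[OF ex1_braid_C[OF x(2) y(2)]])
  then show "x' \<in> carrier (YT_C A) \<and> y' \<in> carrier (YT_C A) \<and>
      C.is_split (enc_C x) (enc_C y) (enc_C y') (enc_C x')"
    unfolding s unfolding x(1) y(1) using is_braid_C_iff[OF x(2) y(2)]
    by (cases x'; cases y') (simp add: YT_C_def del: is_braid_C.simps)
qed

theorem theorem4p7: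
  fixes A :: "'a::linorder set"
  shows
    "((\<forall>(T1, a1) \<in> carrier (YT_R A). \<forall>(T2, a2) \<in> carrier (YT_R A).
          rows (T1 \<ast> T2) \<le> a1 + a2 + rows T1 + rows T2) \<and>
      (\<forall>p \<in> carrier (YT_R A) \<times> carrier (YT_R A). \<exists>!q. is_braid_R A p q) \<and>
      braided_commutative_monoid (YT_R A) (\<sigma>\<^sub>R A)) \<and>
     ((\<forall>(T1, a1) \<in> carrier (YT_C A). \<forall>(T2, a2) \<in> carrier (YT_C A).
          cols (T1 \<ast> T2) \<le> a1 + a2 + cols T1 + cols T2) \<and>
      (\<forall>p \<in> carrier (YT_C A) \<times> carrier (YT_C A). \<exists>!q. is_braid_C A p q) \<and>
      braided_commutative_monoid (YT_C A) (\<sigma>\<^sub>C A))"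
proof (intro conjI braided_commutative_monoid_R braided_commutative_monoid_C)
  show "\<forall>(T1, a1) \<in> carrier (YT_R A). \<forall>(T2, a2) \<in> carrier (YT_R A).
      rows (T1 \<ast> T2) \<le> a1 + a2 + rows T1 + rows T2"
    by (auto simp: YT_R_def dest: rows_mult_le)
  show "\<forall>(T1, a1) \<in> carrier (YT_C A). \<forall>(T2, a2) \<in> carrier (YT_C A).
      cols (T1 \<ast> T2) \<le> a1 + a2 + cols T1 + cols T2"
    by (auto simp: YT_C_def dest: cols_mult_le)
  show "\<forall>p \<in> carrier (YT_R A) \<times> carrier (YT_R A). \<exists>!q. is_braid_R A p q"
    by (simp add: YT_R_def ex1_braid_R del: is_braid_R.simps)
  show "\<forall>p \<in> carrier (YT_C A) \<times> carrier (YT_C A). \<exists>!q. is_braid_C A p q"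
    by (simp add: YT_C_def ex1_braid_C del: is_braid_C.simps)
qed

end
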